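(* Under the standing setup in the context, let $\gamma_k=\gamma_0(1+\delta k)^{-3/4}$ and $\eta_k=\eta_0(1+\delta k)^{-1}$ with $\gamma_0,\eta_0>0$ and $0<\delta\le\frac45\mu\eta_0$, and let $\bar\kappa\ge0$ be an integer such that for all $k\ge\bar\kappa$: $\eta_k(\mu+L)+\gamma_k\rho_N\le2$ and $\frac{\eta_k}{\gamma_k}\le\frac{\zeta\mu\rho_2}{\sqrt N\nabla^*L}$. Then for all $k\ge\bar\kappa$: $$\frac{1}{\sqrt N}\|\mathbf W_k-\overline{\mathbf W}_k\|_{\mathbb E}\le\frac{\sqrt5\,e}{2\sqrt\mu}\Big[\frac{\gamma_0}{\sqrt{\eta_0}}\sqrt{\Sigma^{(1)}}+\sqrt{\eta_0\Sigma^{(2)}}(1+\delta k)^{-1/4}\Big](1+\delta k)^{-1/4},$$ $$\frac{1}{\sqrt N}\|\overline{\mathbf W}_k-\mathbf W_k^*\|_{\mathbb E}\le\mathrm{dm}(\mathcal W)\Big(1+\frac{\delta(k-\bar\kappa)}{1+\delta\bar\kappa}\Big)^{-5/4}+\frac{\nabla^*L}{\mu\rho_2}\frac e4\frac{\eta_0}{\gamma_0}\Big(1+\frac{L^2}{\mu\rho_2}\frac{\eta_0}{\gamma_0}(1+\delta k)^{-1/4}\Big)(1+\delta k)^{-1/4},$$ $$\frac{1}{\sqrt N}\|\mathbf W_k^*-\mathbf W^*\|\le\frac{\nabla^*L}{\mu\rho_2}\frac{\eta_0}{\gamma_0}(1+\delta k)^{-1/4}.$$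
   Context: Standing setup. Let $N\ge2$, $d\ge1$. For $i=1,\dots,N$, $f_i:\mathbb R^d\to\mathbb R$ is $\mu$-strongly convex and $L$-smooth (gradient $L$-Lipschitz), $0<\mu\le L$. Let $F(\mathbf w)=\frac1N\sum_i f_i(\mathbf w)$ with unique minimizer $\mathbf w^*\in\mathbb R^d$. Let $\mathcal W\subset\mathbb R^d$ be nonempty, closed, convex, bounded with $\mathbf w^*\in\mathrm{int}(\mathcal W)$; $\zeta\triangleq\min_{\mathbf w\in\mathrm{bd}(\mathcal W)}\|\mathbf w-\mathbf w^*\|>0$; $\mathrm{dm}(\mathcal W)\triangleq\max_{\mathbf w,\mathbf w'\in\mathcal W}\|\mathbf w-\mathbf w'\|$; $\nabla^*\triangleq\max_i\|\nabla f_i(\mathbf w^* )\|$. Let $\mathbf L\in\mathbb R^{N\times N}$ be a Laplacian matrix: symmetric, off-diagonal entries $\le0$, $\mathbf L\mathbf 1_N=\mathbf 0$; its eigenvalues are $0=\rho_1\le\rho_2\le\dots\le\rho_N$, and $\rho_2>0$. Set $\hat{\mathbf L}=\mathbf L\otimes\mathbf I_d$. For $\mathbf W=[\mathbf w_1^\top,\dots,\mathbf w_N^\top]^\top\in\mathbb R^{Nd}$ let $f(\mathbf W)=\sum_i f_i(\mathbf w_i)$, and $\mathbf W^*=\mathbf 1_N\otimes\mathbf w^*$. $\Pi^N$ denotes Euclidean projection onto $\mathcal W^N$. Given stepsizes $\eta_k,\gamma_k>0$, define $G_k(\mathbf W)=f(\mathbf W)+\frac{\gamma_k}{2\eta_k}\mathbf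 W^\top\hat{\mathbf L}\mathbf W$ and $\mathbf W_k^*=\arg\min_{\mathbf W\in\mathcal W^N}G_k(\mathbf W)$. On a probability space with filtration $(\mathcal F_k)$, fix an integer $\bar\kappa\ge0$ and an $\mathcal F_{\bar\kappa}$-measurable $\mathbf W_{\bar\kappa}\in\mathcal W^N$, and define for $k\ge\bar\kappa$ $$\mathbf W_{k+1}=\Pi^N\big[\mathbf W_k-\eta_k\nabla G_k(\mathbf W_k)+\gamma_k\boldsymbol\epsilon_k^{(1)}-\eta_k\boldsymbol\epsilon_k^{(2)}\big],$$ where $\boldsymbol\epsilon_k^{(1)},\boldsymbol\epsilon_k^{(2)}\in\mathbb R^{Nd}$ are $\mathcal F_{k+1}$-measurable with $\mathbb E[\boldsymbol\epsilon_k^{(1)}|\mathcal F_k]=\mathbb E[\boldsymbol\epsilon_k^{(2)}|\mathcal F_k]=\mathbf 0$, $\mathbb E[\langle\boldsymbol\epsilon_k^{(1)},\boldsymbol\epsilon_k^{(2)}\rangle|\mathcal F_k]=0$, and $\frac1N\mathbb E[\|\boldsymbol\epsilon_k^{(1)}\|^2|\mathcal F_k]\le\Sigma^{(1)}$, $\frac1N\mathbb E[\|\boldsymbol\epsilon_k^{(2)}\|^2|\mathcal F_k]\le\Sigma^{(2)}$ for constants $\Sigma^{(1)},\Sigma^{(2)}\ge0$. The noise-free dynamics are $\overline{\mathbf W}_{\bar\kappa}=\mathbf W_{\bar\kappa}$, $\overline{\mathbf W}_{k+1}=\Pi^N[\overline{\mathbf W}_k-\eta_k\nabla G_k(\overline{\mathbf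 W}_k)]$ for $k\ge\bar\kappa$. For a random vector $\mathbf a$, $\|\mathbf a\|_{\mathbb E}\triangleq\sqrt{\mathbb E\|\mathbf a\|^2}$. *)

theory Defs
  imports "HOL-Analysis.Analysis" "HOL-Probability.Probability"
begin

text \<open>A stacked vector W in R^(N d) is an element of type 'a^'n, where 'a is R^d
  (an arbitrary Euclidean space) and the finite type 'n indexes the N agents.\<close>

definition strongly_convex_on :: "'a::real_inner set \<Rightarrow> real \<Rightarrow> ('a \<Rightarrow> real) \<Rightarrow> bool" where
  "strongly_convex_on S mu g \<longleftrightarrow> convex_on S (\<lambda>x. g x - mu / 2 * (norm x)\<^sup>2)"

definition WN :: "'a set \<Rightarrow> ('a ^ 'n) set" where
  "WN S = {W. \<forall>i. W $ i \<in> S}"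

definition projN :: "'a::euclidean_space set \<Rightarrow> 'a ^ 'n \<Rightarrow> 'a ^ 'n" where
  "projN S W = closest_point (WN S) W"

definition lapmul :: "real ^ 'n ^ 'n \<Rightarrow> ('a::real_vector) ^ 'n \<Rightarrow> 'a ^ 'n" where
  "lapmul Lp W = (\<chi> i. \<Sum>j\<in>UNIV. (Lp $ i $ j) *\<^sub>R (W $ j))"

definition fstack :: "('n \<Rightarrow> 'a \<Rightarrow> real) \<Rightarrow> 'a ^ 'n \<Rightarrow> real" where
  "fstack f W = (\<Sum>i\<in>UNIV. f i (W $ i))"

definition Gfun :: "('n::finite \<Rightarrow> 'a::real_inner \<Rightarrow> real) \<Rightarrow> real ^ 'n ^ 'n \<Rightarrow> real \<Rightarrow> real \<Rightarrow> 'a ^ 'n \<Rightarrow> real" where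
  "Gfun f Lp gam eta W = fstack f W + gam / (2 * eta) * (W \<bullet> lapmul Lp W)"

text \<open>Gradient of G_k, given the gradients grad i of the f_i (L symmetric):
  grad f(W) + (gamma/eta) (L \<otimes> I_d) W.\<close>
definition gradG :: "('n::finite \<Rightarrow> 'a::real_inner \<Rightarrow> 'a) \<Rightarrow> real ^ 'n ^ 'n \<Rightarrow> real \<Rightarrow> real \<Rightarrow> 'a ^ 'n \<Rightarrow> 'a ^ 'n" where
  "gradG grad Lp gam eta W = (\<chi> i. grad i (W $ i)) + (gam / eta) *\<^sub>R lapmul Lp W"

definition eta_k :: "real \<Rightarrow> real \<Rightarrow> nat \<Rightarrow> real" where
  "eta_k eta0 dlt k = eta0 * (1 + dlt * real k) powr (-1)"

definition gam_k :: "real \<Rightarrow> real \<Rightarrow> nat \<Rightarrow> real" where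
  "gam_k gam0 dlt k = gam0 * (1 + dlt * real k) powr (-3/4)"

definition Enorm :: "'w measure \<Rightarrow> ('w \<Rightarrow> 'b::real_normed_vector) \<Rightarrow> real" where
  "Enorm M X = sqrt (\<integral>\<omega>. (norm (X \<omega>))\<^sup>2 \<partial>M)"

end

theory Submission
  imports Defs
begin

text \<open>
  Each \<open>G k\<close> is \<open>mu\<close>-strongly convex, and under the step size condition the map
  \<open>X \<mapsto> X - eta k \<nabla>G k X\<close> contracts by \<open>1 - eta k mu\<close> (cocoercivity of the gradients
  and of the Laplacian). Its fixed point \<open>Z k\<close> is the unconstrained minimiser of \<open>G k\<close>. Stationarity
  forces the local gradients at \<open>Z k\<close> to sum to zero, so gradient differences only see deviations from
  consensus, on which the Laplacian is bounded below by \<open>rho 2\<close>. This bounds \<open>Z k - W*\<close>, whence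
  \<open>Z k\<close> lies in the constraint set and is the constrained minimiser, and it also bounds the drift
  \<open>Z (k + 1) - Z k\<close>. The two remaining estimates are inductions on \<open>k\<close>: the noise-free iterates satisfy
  \<open>D (k + 1) \<le> (1 - eta k mu) D k + drift\<close>, the mean squared noise error satisfies
  \<open>V (k + 1) \<le> (1 - eta k mu)^2 V k + N (gam k^2 Sig1 + eta k^2 Sig2)\<close>, and both close up because
  \<open>(1 + x)^(-p) \<ge> 1 - p x\<close>.
\<close>

section \<open>Gradients of smooth strongly convex functions\<close>

text \<open>Subtracting the quadratic \<open>mu / 2 * (norm z)^2\<close> leaves a convex function,
  whose restriction to the line through \<open>x\<close> and \<open>y\<close> lies above its tangent
  at \<open>x\<close>.\<close>

lemma strongly_convex_gradient_lower_bound: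
  fixes g :: "'a::real_inner \<Rightarrow> real"
  assumes "strongly_convex_on UNIV mu g"
    and "(g has_derivative (\<lambda>h. u \<bullet> h)) (at x)"
  shows "g x + u \<bullet> (y - x) + mu / 2 * (norm (y - x))\<^sup>2 \<le> g y"
proof -
  define q where "q z = g z - mu / 2 * (norm z)\<^sup>2" for z
  define p where "p t = q (x + t *\<^sub>R (y - x))" for t :: real
  have q: "convex_on UNIV q"
    using assms(1) unfolding strongly_convex_on_def q_def[abs_def] .
  have conv: "convex_on UNIV p"
  proof (rule convex_onI)
    fix t a b :: real assume t: "0 < t" "t < 1"
    have "x + ((1 - t) *\<^sub>R a + t *\<^sub>R b) *\<^sub>R (y - x)
        = (1 - t) *\<^sub>R (x + a *\<^sub>R (y - x)) + t *\<^sub>R (x + b *\<^sub>R (y - x))"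
      by (simp add: algebra_simps)
    then show "p ((1 - t) *\<^sub>R a + t *\<^sub>R b) \<le> (1 - t) * p a + t * p b"
      using convex_onD[OF q, of t] t by (simp add: p_def)
  qed simp
  have "((\<lambda>t. g (x + t *\<^sub>R (y - x))) has_derivative (\<lambda>t. u \<bullet> (t *\<^sub>R (y - x)))) (at 0)"
    by (rule has_derivative_compose[where g = g and s = UNIV and f = "\<lambda>t. x + t *\<^sub>R (y - x)", simplified])
      (auto intro!: derivative_eq_intros assms(2))
  then have 1: "((\<lambda>t. g (x + t *\<^sub>R (y - x))) has_real_derivative (u \<bullet> (y - x))) (at 0)"
    by (simp add: has_field_derivative_def mult.commute[of _ "u \<bullet> _"] cong: if_cong)
  have 2: "((\<lambda>t. mu / 2 * (norm (x + t *\<^sub>R (y - x)))\<^sup>2) has_real_derivative (mu * (x \<bullet> (y - x)))) (at 0)"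
    unfolding power2_norm_eq_inner inner_add_left inner_add_right inner_scaleR_left inner_scaleR_right
    by (auto intro!: derivative_eq_intros simp: inner_commute)
  have "(p has_real_derivative (u \<bullet> (y - x) - mu * (x \<bullet> (y - x)))) (at 0)"
    unfolding p_def q_def by (intro DERIV_diff 1 2)
  from convex_on_imp_above_tangent[OF conv _ _ _, of 0 1 "u \<bullet> (y - x) - mu * (x \<bullet> (y - x))"] this
  have "p 1 - p 0 \<ge> u \<bullet> (y - x) - mu * (x \<bullet> (y - x))"
    by simp
  moreover have "(norm y)\<^sup>2 = (norm (y - x))\<^sup>2 + (norm x)\<^sup>2 + 2 * (x \<bullet> (y - x))"
    by (simp add: power2_norm_eq_inner algebra_simps inner_commute)
  ultimately show ?thesis
    unfolding p_def q_def by (simp add: algebra_simps)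
qed

text \<open>Along the segment from \<open>x\<close> to \<open>y\<close>, \<open>g\<close> minus the
  claimed quadratic bound has nonpositive derivative, because the gradient changes by at most
  \<open>L * t * norm (y - x)\<close>.\<close>

lemma lipschitz_gradient_upper_bound:
  fixes g :: "'a::real_inner \<Rightarrow> real"
  assumes grad: "\<And>x. (g has_derivative (\<lambda>h. grad x \<bullet> h)) (at x)"
    and lip: "L-lipschitz_on UNIV grad"
  shows "g y \<le> g x + grad x \<bullet> (y - x) + L / 2 * (norm (y - x))\<^sup>2"
proof -
  define h where "h = y - x"
  define p where "p t = g (x + t *\<^sub>R h) - t * (grad x \<bullet> h) - L / 2 * (t\<^sup>2 * (norm h)\<^sup>2)" for t
  have der: "(p has_real_derivative (grad (x + t *\<^sub>R h) \<bullet> h - grad x \<bullet> h - L * t * (norm h)\<^sup>2)) (at t)" for t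
  proof -
    have "((\<lambda>t. g (x + t *\<^sub>R h)) has_derivative (\<lambda>s. grad (x + t *\<^sub>R h) \<bullet> (s *\<^sub>R h))) (at t)"
      by (rule has_derivative_compose[where g = g and s = UNIV and f = "\<lambda>t. x + t *\<^sub>R h", simplified])
        (auto intro!: derivative_eq_intros grad)
    then have 1: "((\<lambda>t. g (x + t *\<^sub>R h)) has_real_derivative (grad (x + t *\<^sub>R h) \<bullet> h)) (at t)"
      by (simp add: has_field_derivative_def mult.commute[of _ "grad _ \<bullet> _"])
    show ?thesis
      unfolding p_def by (auto intro!: derivative_eq_intros 1)
  qed
  have "p 1 \<le> p 0"
  proof (rule DERIV_nonpos_imp_nonincreasing[of 0 1 p])
    fix t :: real assume t: "0 \<le> t" "t \<le> 1"
    have "grad (x + t *\<^sub>R h) \<bullet> h - grad x \<bullet> h = (grad (x + t *\<^sub>R h) - grad x) \<bullet> h"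
      by (simp add: inner_diff_left)
    also have "\<dots> \<le> norm (grad (x + t *\<^sub>R h) - grad x) * norm h"
      by (rule norm_cauchy_schwarz)
    also have "\<dots> \<le> (L * (t * norm h)) * norm h"
      using lipschitz_onD[OF lip, of "x + t *\<^sub>R h" x] t
      by (intro mult_right_mono) (auto simp: dist_norm)
    finally show "\<exists>z. DERIV p t :> z \<and> z \<le> 0"
      using der by (intro exI conjI) (auto simp: power2_eq_square algebra_simps)
  qed simp
  then show ?thesis
    by (simp add: p_def h_def algebra_simps)
qed

text \<open>Comparing the lower bound based at \<open>x\<close> with the upper bound based at \<open>y\<close> at the point
  \<open>y - t d\<close>, where \<open>d\<close> is the difference of the two shifted gradients.\<close>

lemma shifted_gradient_cocoercive:
  fixes g :: "'a::real_inner \<Rightarrow> real"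
  assumes grad: "\<And>x. (g has_derivative (\<lambda>h. grad x \<bullet> h)) (at x)"
    and sc: "strongly_convex_on UNIV mu g"
    and lip: "L-lipschitz_on UNIV grad"
    and le: "mu \<le> L"
  defines "d \<equiv> \<lambda>x y. grad y - grad x - mu *\<^sub>R (y - x)"
  shows "(norm (d x y))\<^sup>2 \<le> (L - mu) * (d x y \<bullet> (y - x))" "0 \<le> d x y \<bullet> (y - x)"
proof -
  define D where "D = d x y"
  have lo: "g a + grad a \<bullet> (b - a) + mu / 2 * (norm (b - a))\<^sup>2 \<le> g b" for a b
    by (rule strongly_convex_gradient_lower_bound[OF sc grad])
  have up: "g b \<le> g a + grad a \<bullet> (b - a) + L / 2 * (norm (b - a))\<^sup>2" for a b
    by (rule lipschitz_gradient_upper_bound[OF grad lip])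
  show nn: "0 \<le> d x y \<bullet> (y - x)"
    using lo[of x y] lo[of y x]
    by (simp add: d_def algebra_simps power2_norm_eq_inner inner_commute)
  \<comment> \<open>The parameter \<open>t\<close> stays free: its best value
    \<open>1 / (L - mu)\<close> makes sense only for \<open>mu < L\<close>.\<close>
  have half: "g a - g b + grad a \<bullet> (b - a) + mu / 2 * (norm (b - a))\<^sup>2
      + (t - (L - mu) / 2 * t\<^sup>2) * (norm (d a b))\<^sup>2 \<le> 0" for a b t
  proof -
    define e E where "e = b - a" and "E = d a b"
    have gb: "grad b = grad a + mu *\<^sub>R e + E"
      by (simp add: e_def E_def d_def)
    have "g a + grad a \<bullet> (e - t *\<^sub>R E) + mu / 2 * (norm (e - t *\<^sub>R E))\<^sup>2 \<le> g (b - t *\<^sub>R E)"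
      using lo[of a "b - t *\<^sub>R E"] by (simp add: e_def algebra_simps)
    also have "\<dots> \<le> g b - t * (grad b \<bullet> E) + L / 2 * (t\<^sup>2 * (norm E)\<^sup>2)"
      using up[of "b - t *\<^sub>R E" b] by (simp add: power_mult_distrib)
    finally show ?thesis
      unfolding gb e_def[symmetric] E_def[symmetric] power2_norm_eq_inner
      by (simp add: algebra_simps inner_commute power2_eq_square diff_divide_distrib)
  qed
  \<comment> \<open>Adding \<open>half\<close> for the pairs \<open>(x, y)\<close> and
    \<open>(y, x)\<close> cancels the function values.\<close>
  have key: "(2 * t - (L - mu) * t\<^sup>2) * (norm D)\<^sup>2 \<le> D \<bullet> (y - x)" for t
  proof -
    have "norm (d y x) = norm D"
      unfolding D_def d_def by (subst norm_minus_commute[symmetric]) (simp add: algebra_simps)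
    then have "(2 * t - (L - mu) * t\<^sup>2) * (norm D)\<^sup>2
        \<le> (grad y - grad x) \<bullet> (y - x) - mu * (norm (y - x))\<^sup>2"
      using half[of x y t] half[of y x t]
      by (simp add: norm_minus_commute[of x y] inner_diff_left inner_diff_right D_def[symmetric] algebra_simps
          diff_divide_distrib)
    also have "\<dots> = D \<bullet> (y - x)"
      by (simp add: D_def d_def power2_norm_eq_inner inner_diff_left)
    finally show ?thesis .
  qed
  show "(norm (d x y))\<^sup>2 \<le> (L - mu) * (d x y \<bullet> (y - x))"
  proof (cases "L = mu")
    case True
    have "D = 0"
    proof (rule ccontr)
      assume "D \<noteq> 0"
      \<comment> \<open>With \<open>L = mu\<close> the left side of \<open>key\<close> is linear in
        \<open>t\<close>, and this \<open>t\<close> makes it exceed the right side by exactly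
        1.\<close>
      then show False
        using key[of "(1 + D \<bullet> (y - x)) / (2 * (norm D)\<^sup>2)"] True by simp
    qed
    then show ?thesis
      by (simp add: D_def)
  next
    case False
    define c where "c = L - mu"
    have c: "c > 0"
      using False le by (simp add: c_def)
    have "2 * (1 / c) - c * (1 / c)\<^sup>2 = 1 / c"
      using c by (simp add: field_simps power2_eq_square)
    then have "1 / c * (norm D)\<^sup>2 \<le> D \<bullet> (y - x)"
      using key[of "1 / c"] by (simp add: c_def)
    then show ?thesis
      using c unfolding D_def[symmetric] c_def[symmetric] by (simp add: field_simps)
  qed
qed

section \<open>Spectrum of the Laplacian\<close>

text \<open>Compactness gives a minimiser of the quadratic form on the unit sphere of
  \<open>S\<close>; perturbing it along its own residual \<open>T v - lam *\<^sub>R v\<close> shows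
  that the residual vanishes.\<close>

lemma self_adjoint_rayleigh_minimiser:
  fixes T :: "'b::euclidean_space \<Rightarrow> 'b"
  assumes lin: "linear T" and adj: "\<And>x y. x \<bullet> T y = T x \<bullet> y"
    and S: "subspace S" "z \<in> S" "z \<noteq> 0" and inv: "\<And>x. x \<in> S \<Longrightarrow> T x \<in> S"
  obtains v lam where "v \<in> S" "v \<noteq> 0" "T v = lam *\<^sub>R v"
    "\<And>x. x \<in> S \<Longrightarrow> lam * (norm x)\<^sup>2 \<le> x \<bullet> T x"
proof -
  have "compact (S \<inter> sphere 0 1)"
    by (intro closed_Int_compact closed_subspace S) auto
  moreover have "(1 / norm z) *\<^sub>R z \<in> S \<inter> sphere 0 1"
    using S by (auto simp: subspace_scale)
  moreover have "continuous_on (S \<inter> sphere 0 1) (\<lambda>x. x \<bullet> T x)"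
    by (intro continuous_intros linear_continuous_on_compose[OF _ lin])
  ultimately obtain v where v: "v \<in> S" "norm v = 1"
    and min: "\<And>x. x \<in> S \<Longrightarrow> norm x = 1 \<Longrightarrow> v \<bullet> T v \<le> x \<bullet> T x"
    using continuous_attains_inf[of "S \<inter> sphere 0 1" "\<lambda>x. x \<bullet> T x"] by fastforce
  define lam where "lam = v \<bullet> T v"
  have low: "lam * (norm x)\<^sup>2 \<le> x \<bullet> T x" if x: "x \<in> S" for x
  proof (cases "x = 0")
    case False
    then have "lam \<le> ((1 / norm x) *\<^sub>R x) \<bullet> T ((1 / norm x) *\<^sub>R x)"
      unfolding lam_def by (intro min) (use S(1) x in \<open>auto simp: subspace_scale\<close>)
    also have "\<dots> = (x \<bullet> T x) / (norm x)\<^sup>2"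
      by (simp add: linear_cmul[OF lin] power2_eq_square)
    finally show ?thesis
      using False by (simp add: field_simps)
  qed (simp add: linear_0[OF lin])
  define w where "w = T v - lam *\<^sub>R v"
  have w: "w \<in> S"
    unfolding w_def by (intro subspace_diff subspace_scale S inv v)
  \<comment> \<open>Minimality along \<open>v + t *\<^sub>R w\<close>. The term linear in
    \<open>t\<close> is \<open>2 * t * (norm w)^2\<close>, since \<open>v\<close> is orthogonal to
    \<open>w\<close>.\<close>
  have quad: "0 \<le> 2 * t * (norm w)\<^sup>2 + t\<^sup>2 * (w \<bullet> T w - lam * (norm w)\<^sup>2)" for t
  proof -
    have "lam * (norm (v + t *\<^sub>R w))\<^sup>2 \<le> (v + t *\<^sub>R w) \<bullet> T (v + t *\<^sub>R w)"
      by (intro low subspace_add subspace_scale S v w)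
    moreover have Tv: "T v = lam *\<^sub>R v + w"
      by (simp add: w_def)
    moreover have "v \<bullet> v = 1"
      using v(2) by (simp add: norm_eq_1)
    moreover from this have "v \<bullet> w = 0"
      by (simp add: w_def inner_diff_right lam_def)
    moreover from this have "v \<bullet> T w = w \<bullet> w"
      by (simp add: adj Tv inner_add_left)
    ultimately show ?thesis
      unfolding power2_norm_eq_inner
      by (simp add: linear_add[OF lin] linear_cmul[OF lin] algebra_simps inner_commute power2_eq_square)
  qed
  have "w = 0"
  proof (rule ccontr)
    assume "w \<noteq> 0"
    define a where "a = (norm w)\<^sup>2"
    define b where "b = w \<bullet> T w - lam * (norm w)\<^sup>2"
    have ab: "a > 0" "b \<ge> 0"
      using \<open>w \<noteq> 0\<close> low[OF w] by (auto simp: a_def b_def)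
    \<comment> \<open>A negative \<open>t\<close> for which the linear term dominates; the
      \<open>+ 1\<close> keeps the denominator positive when \<open>b = 0\<close>.\<close>
    define t where "t = - a / (b + 1)"
    have "t * (b + 1) = - a"
      using ab by (simp add: t_def)
    then have "2 * t * a + t\<^sup>2 * b = t * (a - t)"
      by algebra
    also have "\<dots> < 0"
      using ab by (intro mult_neg_pos) (simp_all add: t_def divide_neg_pos divide_nonneg_pos add_pos_nonneg)
    finally show False
      using quad[of t] by (simp add: a_def b_def)
  qed
  then show thesis
    using that[of v lam] v low by (force simp: w_def)
qed

lemma det_eq_0_if_eigenvector:
  fixes A :: "real ^ 'n ^ 'n"
  assumes "A *v v = lam *\<^sub>R v" "v \<noteq> 0"
  shows "det (lam *\<^sub>R mat 1 - A) = 0"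
proof -
  have "(lam *\<^sub>R mat 1 - A) *v v = 0"
    using assms by (simp add: matrix_vector_mult_diff_rdistrib scaleR_matrix_vector_assoc[symmetric])
  then show ?thesis
    using assms(2) invertible_det_nz[of "lam *\<^sub>R mat 1 - A"]
    by (auto simp: invertible_left_inverse matrix_left_invertible_ker)
qed

text \<open>Two independent kernel vectors, taken as rows \<open>i\<close> and \<open>j\<close> of an otherwise trivial base change,
  let two factors \<open>x\<close> be pulled out of the characteristic polynomial.\<close>

lemma det_factor_two_kernel_vectors:
  fixes A :: "real ^ 'n ^ 'n"
  assumes ker: "A *v u = 0" "A *v v = 0"
    and minor: "u $ i * v $ j \<noteq> u $ j * v $ i"
  obtains q where "continuous_on UNIV q" "\<And>x. det (x *\<^sub>R mat 1 - A) = x\<^sup>2 * q x"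
proof -
  have ij: "i \<noteq> j"
    using minor by auto
  define p where "p k = (if k = i then u else if k = j then v else axis k 1)" for k
  define P where "P = (\<chi> k. p k)"
  define R where "R x = (\<chi> k. if k = i then u else if k = j then v
      else (x *\<^sub>R mat 1 - A) *v p k)" for x
  have "invertible P"
    unfolding invertible_left_inverse matrix_left_invertible_ker
  proof (intro allI impI)
    fix y assume "P *v y = 0"
    then have z: "p k \<bullet> y = 0" for k
      by (simp add: P_def vec_eq_iff matrix_vector_mul_component)
    have "y $ k = 0" if "k \<noteq> i" "k \<noteq> j" for k
      using z[of k] that by (simp add: p_def inner_axis')
    then have "w \<bullet> y = w $ i * y $ i + w $ j * y $ j" for w
      unfolding inner_vec_def using ij
      by (subst sum.mono_neutral_cong_right[of UNIV "{i, j}"]) auto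
    then have "u $ i * y $ i + u $ j * y $ j = 0" "v $ i * y $ i + v $ j * y $ j = 0"
      using z[of i] z[of j] ij by (auto simp: p_def)
    then have "(u $ i * v $ j - u $ j * v $ i) * y $ i = 0" "(u $ i * v $ j - u $ j * v $ i) * y $ j = 0"
      by algebra+
    then have "y $ i = 0" "y $ j = 0"
      using minor by auto
    with \<open>\<And>k. k \<noteq> i \<Longrightarrow> k \<noteq> j \<Longrightarrow> y $ k = 0\<close> show "y = 0"
      by (metis vec_eq_iff zero_index)
  qed
  then have P: "det P \<noteq> 0"
    by (simp add: invertible_det_nz)
  have fac: "det P * det (x *\<^sub>R mat 1 - A) = x\<^sup>2 * det (R x)" for x
  proof -
    let ?B = "x *\<^sub>R mat 1 - A"
    \<comment> \<open>The transpose puts the images \<open>?B *v p k\<close> into the rows, where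
      \<open>det_row_mul\<close> can extract \<open>x\<close> from rows \<open>i\<close> and
      \<open>j\<close>.\<close>
    have "P ** transpose ?B = (\<chi> k. ?B *v p k)"
      by (simp add: vec_eq_iff P_def matrix_matrix_mult_def matrix_vector_mult_def transpose_def mult.commute)
    moreover have "?B *v u = x *s u" "?B *v v = x *s v"
      using ker by (simp_all add: matrix_vector_mult_diff_rdistrib scaleR_matrix_vector_assoc[symmetric]
          scalar_mult_eq_scaleR)
    ultimately have "P ** transpose ?B = (\<chi> k. if k = i then x *s u else if k = j then x *s v else ?B *v p k)"
      by (auto simp: vec_eq_iff p_def)
    then have "det P * det ?B = det (\<chi> k. if k = i then x *s u else if k = j then x *s v else ?B *v p k)"
      by (metis det_mul det_transpose)
    also have "\<dots> = x * det (\<chi> k. if k = i then u else if k = j then x *s v else ?B *v p k)"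
      by (rule det_row_mul)
    also have "(\<chi> k. if k = i then u else if k = j then x *s v else ?B *v p k)
        = (\<chi> k. if k = j then x *s v else if k = i then u else ?B *v p k)"
      using ij by (auto simp: vec_eq_iff)
    also have "det \<dots> = x * det (\<chi> k. if k = j then v else if k = i then u else ?B *v p k)"
      by (rule det_row_mul)
    also have "(\<chi> k. if k = j then v else if k = i then u else ?B *v p k) = R x"
      using ij by (auto simp: vec_eq_iff R_def)
    finally show ?thesis
      by (simp add: power2_eq_square)
  qed
  \<comment> \<open>The factorisation determines the quotient only away from 0; continuity is what
    later gives access to the point 0.\<close>
  have "continuous_on UNIV (\<lambda>x. R x $ k $ l)" for k l
    by (cases "k = i"; cases "k = j")
      (auto simp: R_def matrix_vector_mult_def intro!: continuous_intros)
  then have "continuous_on UNIV (\<lambda>x. \<chi> k l. R x $ k $ l)"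
    by (intro continuous_on_vec_lambda)
  then have "continuous_on UNIV R"
    by simp
  then have "continuous_on UNIV (\<lambda>x. det (R x) / det P)"
    unfolding det_def[of "R _"] by (intro continuous_intros) (auto simp: P)
  moreover have "det (x *\<^sub>R mat 1 - A) = x\<^sup>2 * (det (R x) / det P)" for x
    using fac[of x] P by (simp add: field_simps)
  ultimately show thesis
    using that by blast
qed

text \<open>The \<open>rho j\<close> are given as roots of the characteristic polynomial, so they
  count algebraic multiplicity; that the kernel is one-dimensional has to be derived.\<close>

locale laplacian_spectrum =
  fixes A :: "real ^ 'n ^ 'n" and rho :: "nat \<Rightarrow> real"
  assumes two: "CARD('n) \<ge> 2"
    and sym: "transpose A = A"
    and ones: "A *v vec 1 = 0"
    and charpoly: "\<And>x. det (x *\<^sub>R mat 1 - A) = (\<Prod>j\<in>{1..CARD('n)}. x - rho j)"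
    and sorted: "\<And>j. 1 \<le> j \<Longrightarrow> j < CARD('n) \<Longrightarrow> rho j \<le> rho (Suc j)"
    and rho1: "rho 1 = 0" and rho2: "rho 2 > 0"
begin

section \<open>Extremal eigenvalues and the spectral gap\<close>

lemma rho_mono:
  assumes "1 \<le> i" "i \<le> j" "j \<le> CARD('n)"
  shows "rho i \<le> rho j"
  using assms(2,3,1)
proof (induction j rule: dec_induct)
  case (step k)
  then show ?case
    using sorted[of k] by simp
qed simp

lemma rho_last_pos: "0 < rho (CARD('n))"
  using rho2 rho_mono[of 2 "CARD('n)"] two by simp

lemma eigenvalue_cases:
  assumes "A *v v = lam *\<^sub>R v" "v \<noteq> 0"
  shows "lam = 0 \<or> (rho 2 \<le> lam \<and> lam \<le> rho (CARD('n)))"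
proof -
  obtain j where j: "1 \<le> j" "j \<le> CARD('n)" "lam = rho j"
    using det_eq_0_if_eigenvector[OF assms] charpoly[of lam] by auto
  then show ?thesis
    using rho1 rho_mono[of 2 j] rho_mono[of j "CARD('n)"] by (cases "j = 1") auto
qed

lemma adj: "x \<bullet> (A *v y) = (A *v x) \<bullet> y"
  by (metis dot_lmul_matrix sym vector_transpose_matrix)

text \<open>The least Rayleigh quotient is an eigenvalue, and no eigenvalue is negative. The vector
  \<open>vec 1\<close> merely witnesses that the space is nontrivial.\<close>

lemma form_nonneg: "0 \<le> x \<bullet> (A *v x)"
proof -
  have "vec 1 \<noteq> (0 :: real ^ 'n)"
    by (simp add: vec_eq_iff)
  then obtain v lam where v: "v \<noteq> 0" "A *v v = lam *\<^sub>R v"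
    and low: "\<And>x. lam * (norm x)\<^sup>2 \<le> x \<bullet> (A *v x)"
    using self_adjoint_rayleigh_minimiser[of "(*v) A" UNIV "vec 1"] adj by auto
  have "0 \<le> lam"
    using eigenvalue_cases[OF v(2,1)] rho2 by auto
  then show ?thesis
    using low[of x] by (smt (verit) mult_nonneg_nonneg zero_le_power2)
qed

text \<open>The largest Rayleigh quotient of \<open>A\<close> is minus the least one of
  \<open>- A\<close>, hence again an eigenvalue of \<open>A\<close>.\<close>

lemma form_le: "x \<bullet> (A *v x) \<le> rho (CARD('n)) * (norm x)\<^sup>2"
proof -
  have "vec 1 \<noteq> (0 :: real ^ 'n)"
    by (simp add: vec_eq_iff)
  moreover have "linear (\<lambda>x. - (A *v x))"
    by (intro linear_compose_neg) simp
  ultimately obtain v lam where v: "v \<noteq> 0" "- (A *v v) = lam *\<^sub>R v"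
    and low: "\<And>x. lam * (norm x)\<^sup>2 \<le> x \<bullet> - (A *v x)"
    using self_adjoint_rayleigh_minimiser[of "\<lambda>x. - (A *v x)" UNIV "vec 1"] adj by auto
  have "A *v v = (- lam) *\<^sub>R v"
    using v(2) by (metis add.inverse_inverse scaleR_minus_left)
  then have "- lam \<le> rho (CARD('n))"
    using eigenvalue_cases[OF _ v(1)] rho_last_pos by fastforce
  then have "- lam * (norm x)\<^sup>2 \<le> rho (CARD('n)) * (norm x)\<^sup>2"
    by (rule mult_right_mono) simp
  then show ?thesis
    using low[of x] by simp
qed

text \<open>A kernel vector independent of \<open>vec 1\<close> would make 0 a double root of the
  characteristic polynomial, whereas \<open>rho 2 > 0\<close> makes it a simple one.\<close>

lemma kernel_constant:
  assumes "A *v v = 0"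
  shows "v $ i = v $ j"
proof (rule ccontr)
  assume "v $ i \<noteq> v $ j"
  then obtain q where q: "continuous_on UNIV q" "\<And>x. det (x *\<^sub>R mat 1 - A) = x\<^sup>2 * q x"
    using det_factor_two_kernel_vectors[OF ones assms, of i j] by auto
  \<comment> \<open>The characteristic polynomial with its factor \<open>x - rho 1 = x\<close>
    removed.\<close>
  define r where "r x = (\<Prod>j\<in>{2..CARD('n)}. x - rho j)" for x
  have "{1..CARD('n)} = insert 1 {2..CARD('n)}"
    using two by auto
  then have *: "x * r x = x\<^sup>2 * q x" for x
    using charpoly[of x] q(2)[of x] rho1 by (simp add: r_def)
  have "continuous_on UNIV (\<lambda>x. r x - x * q x)"
    unfolding r_def by (intro continuous_intros q)
  then have "((\<lambda>x. r x - x * q x) \<longlongrightarrow> r 0) (at 0)"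
    by (auto simp: continuous_on_eq_continuous_at isCont_def dest!: spec[of _ 0])
  \<comment> \<open>In \<open>*\<close> the factor \<open>x\<close> cancels only for nonzero
    \<open>x\<close>; the value of \<open>r\<close> at 0 is recovered as a limit.\<close>
  moreover have "((\<lambda>x. r x - x * q x) \<longlongrightarrow> 0) (at 0)"
  proof (rule tendsto_eventually)
    have "r x - x * q x = 0" if "x \<noteq> 0" for x
      using *[of x] that by (simp add: power2_eq_square)
    then show "\<forall>\<^sub>F x in at 0. r x - x * q x = 0"
      by (auto simp: eventually_at_filter)
  qed
  ultimately have "r 0 = 0"
    using tendsto_unique by (metis trivial_limit_at)
  then obtain j where "2 \<le> j" "j \<le> CARD('n)" "rho j = 0"
    by (auto simp: r_def)
  then show False
    using rho_mono[of 2 j] rho2 by auto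
qed

text \<open>By symmetry \<open>A\<close> preserves the complement of \<open>vec 1\<close>. The least
  Rayleigh quotient there is an eigenvalue, nonzero because kernel vectors are constant, hence at
  least \<open>rho 2\<close>.\<close>

lemma form_ge_orthogonal:
  assumes "x \<bullet> vec 1 = 0"
  shows "rho 2 * (norm x)\<^sup>2 \<le> x \<bullet> (A *v x)"
proof (cases "x = 0")
  case False
  let ?S = "{x. x \<bullet> vec 1 = 0}"
  have "(A *v y) \<bullet> vec 1 = 0" for y
    using adj[of y "vec 1"] ones by simp
  then obtain v lam where v: "v \<in> ?S" "v \<noteq> 0" "A *v v = lam *\<^sub>R v"
    and low: "\<And>x. x \<in> ?S \<Longrightarrow> lam * (norm x)\<^sup>2 \<le> x \<bullet> (A *v x)"
    using self_adjoint_rayleigh_minimiser[of "(*v) A" ?S x] adj False assms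
    by (auto simp: subspace_hyperplane2)
  have "lam \<noteq> 0"
  proof
    assume "lam = 0"
    then have const: "v $ i = v $ j" for i j
      using kernel_constant[of v] v by simp
    define c where "c = v $ undefined"
    have "v = vec c"
      using const by (simp add: vec_eq_iff c_def)
    then show False
      using v(1,2) by (simp add: inner_vec_def vec_eq_iff)
  qed
  then have "rho 2 \<le> lam"
    using eigenvalue_cases[OF v(3,2)] by simp
  then have "rho 2 * (norm x)\<^sup>2 \<le> lam * (norm x)\<^sup>2"
    by (rule mult_right_mono) simp
  also have "\<dots> \<le> x \<bullet> (A *v x)"
    using low assms by simp
  finally show ?thesis .
qed simp

lemma cocoercive: "(norm (A *v x))\<^sup>2 \<le> rho (CARD('n)) * (x \<bullet> (A *v x))"
proof -
  define r where "r = rho (CARD('n))"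
  have r: "r > 0"
    using rho_last_pos by (simp add: r_def)
  define y where "y = A *v x"
  have "0 \<le> (r *\<^sub>R x - y) \<bullet> (A *v (r *\<^sub>R x - y))"
    by (rule form_nonneg)
  also have "\<dots> = r\<^sup>2 * (x \<bullet> y) - 2 * r * (norm y)\<^sup>2 + y \<bullet> (A *v y)"
    using adj[of x y] unfolding power2_norm_eq_inner
    by (simp add: matrix_vector_mult_diff_distrib matrix_vector_mult_scaleR y_def[symmetric]
        algebra_simps inner_commute power2_eq_square)
  also have "y \<bullet> (A *v y) \<le> r * (norm y)\<^sup>2"
    unfolding r_def by (rule form_le)
  finally have "r * (norm y)\<^sup>2 \<le> r * (r * (x \<bullet> y))"
    by (simp add: power2_eq_square algebra_simps)
  then show ?thesis
    using r by (simp add: y_def r_def)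
qed

end

section \<open>Stationary points of the penalised objective\<close>

text \<open>For \<open>b\<close> in \<open>Basis\<close> this collects one coordinate of all agents.
  On each slice the Kronecker product of the Laplacian with the identity acts as \<open>A\<close>
  itself, so spectral bounds lift by summing over \<open>Basis\<close>.\<close>

definition slice :: "'a::real_inner \<Rightarrow> 'a ^ 'n \<Rightarrow> real ^ 'n" where
  "slice b W = (\<chi> i. W $ i \<bullet> b)"

lemma inner_eq_sum_slice:
  fixes X Y :: "'a::euclidean_space ^ 'n"
  shows "X \<bullet> Y = (\<Sum>b\<in>Basis. slice b X \<bullet> slice b Y)"
  unfolding inner_vec_def slice_def
  by (simp, subst euclidean_inner, rule sum.swap)

lemma slice_lapmul: "slice b (lapmul A W) = A *v slice b W"
  by (simp add: slice_def lapmul_def matrix_vector_mult_def vec_eq_iff inner_sum_left)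

lemma norm_power2_eq_sum_vec: "(norm X)\<^sup>2 = (\<Sum>i\<in>UNIV. (norm (X $ i))\<^sup>2)"
  for X :: "'a::real_inner ^ 'n"
  by (simp add: power2_norm_eq_inner inner_vec_def)

lemma norm_power2_eq_sum_slice: "(norm X)\<^sup>2 = (\<Sum>b\<in>Basis. (norm (slice b X))\<^sup>2)"
  for X :: "'a::euclidean_space ^ 'n"
  by (simp add: power2_norm_eq_inner inner_eq_sum_slice[of X])

lemma linear_lapmul: "linear (lapmul A)"
  by (rule linearI)
    (simp_all add: lapmul_def vec_eq_iff scaleR_right_distrib sum.distrib scaleR_sum_right mult.commute)

lemma continuous_on_lapmul [continuous_intros]:
  fixes g :: "'c::topological_space \<Rightarrow> 'a::real_normed_vector ^ 'n"
  assumes "continuous_on S g"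
  shows "continuous_on S (\<lambda>x. lapmul A (g x))"
  unfolding lapmul_def by (intro continuous_intros assms)

lemma norm_vec_le:
  fixes X :: "'a::real_inner ^ 'n"
  assumes "\<And>i. norm (X $ i) \<le> c" "0 \<le> c"
  shows "norm X \<le> sqrt (real CARD('n)) * c"
proof (rule power2_le_imp_le)
  have "(norm X)\<^sup>2 \<le> (\<Sum>i\<in>(UNIV :: 'n set). c\<^sup>2)"
    unfolding norm_power2_eq_sum_vec by (intro sum_mono power_mono assms) auto
  then show "(norm X)\<^sup>2 \<le> (sqrt (real CARD('n)) * c)\<^sup>2"
    by (simp add: power_mult_distrib)
qed (use assms in auto)

text \<open>The component of \<open>X\<close> orthogonal to the consensus space of all
  \<open>vec c\<close>.\<close>

definition deviation :: "'a::real_vector ^ 'n \<Rightarrow> 'a ^ 'n" where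
  "deviation X = X - vec ((1 / real CARD('n)) *\<^sub>R (\<Sum>i\<in>UNIV. X $ i))"

lemma sum_deviation [simp]: "(\<Sum>i\<in>UNIV. deviation X $ i) = 0"
  by (simp add: deviation_def sum_subtractf sum_constant_scaleR)

lemma inner_vec_right: "V \<bullet> vec c = (\<Sum>i\<in>UNIV. V $ i) \<bullet> c"
  by (simp add: inner_vec_def inner_sum_left)

text \<open>A vector whose entries sum to zero is orthogonal to the consensus space and so does not
  see the mean of \<open>X\<close>.\<close>

lemma inner_deviation:
  "(\<Sum>i\<in>UNIV. V $ i) = 0 \<Longrightarrow> V \<bullet> deviation X = V \<bullet> X"
  by (simp add: deviation_def inner_diff_right inner_vec_right)

section \<open>Lifting the spectral bounds to stacked vectors\<close>

context laplacian_spectrum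
begin

lemma lapmul_vec [simp]: "lapmul A (vec c) = (0 :: 'a::real_vector ^ 'n)"
proof -
  have "(\<Sum>j\<in>UNIV. A $ i $ j) = 0" for i
    using ones by (simp add: vec_eq_iff matrix_vector_mult_def)
  then show ?thesis
    by (simp add: lapmul_def vec_eq_iff flip: scaleR_sum_left)
qed

lemma lapmul_diff: "lapmul A (X - Y) = lapmul A X - lapmul A Y"
  by (rule linear_diff[OF linear_lapmul])

lemma lapmul_deviation [simp]: "lapmul A (deviation X) = lapmul A X"
  by (simp add: deviation_def lapmul_diff)

lemma lapmul_adj: "X \<bullet> lapmul A Y = lapmul A X \<bullet> Y" for X Y :: "'a::euclidean_space ^ 'n"
  by (simp add: inner_eq_sum_slice[of X] inner_eq_sum_slice[of "lapmul A X"] slice_lapmul adj)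

text \<open>Self-adjointness moves the Laplacian onto the constant vector, which it
  annihilates.\<close>

lemma sum_lapmul [simp]: "(\<Sum>i\<in>UNIV. lapmul A X $ i) = 0" for X :: "'a::euclidean_space ^ 'n"
proof -
  have "(\<Sum>i\<in>UNIV. lapmul A X $ i) \<bullet> c = 0" for c
    using lapmul_adj[of X "vec c"] by (simp add: inner_vec_right)
  then show ?thesis
    by (metis inner_eq_zero_iff)
qed

lemma lapmul_nonneg: "0 \<le> X \<bullet> lapmul A X" for X :: "'a::euclidean_space ^ 'n"
  by (auto simp: inner_eq_sum_slice[of X] slice_lapmul intro!: sum_nonneg form_nonneg)

lemma lapmul_cocoercive: "(norm (lapmul A X))\<^sup>2 \<le> rho (CARD('n)) * (X \<bullet> lapmul A X)"
  for X :: "'a::euclidean_space ^ 'n"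
  by (auto simp: inner_eq_sum_slice[of X] norm_power2_eq_sum_slice[of "lapmul A X"] slice_lapmul sum_distrib_left
      intro!: sum_mono cocoercive)

text \<open>Every slice of the deviation is orthogonal to \<open>vec 1\<close>, so the spectral gap
  applies to it, and the form is unchanged by removing the mean.\<close>

lemma lapmul_ge_deviation: "rho 2 * (norm (deviation X))\<^sup>2 \<le> X \<bullet> lapmul A X"
  for X :: "'a::euclidean_space ^ 'n"
proof -
  define E where "E = deviation X"
  have "slice b E \<bullet> vec 1 = 0" for b
  proof -
    have "slice b E \<bullet> vec 1 = (\<Sum>i\<in>UNIV. E $ i) \<bullet> b"
      by (simp add: slice_def inner_vec_def inner_sum_left)
    then show ?thesis
      by (simp add: E_def)
  qed
  then have "rho 2 * (norm E)\<^sup>2 \<le> E \<bullet> lapmul A E"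
    unfolding inner_eq_sum_slice[of E] norm_power2_eq_sum_slice[of E] slice_lapmul sum_distrib_left
    by (intro sum_mono form_ge_orthogonal)
  also have "\<dots> = X \<bullet> lapmul A X"
    using inner_deviation[of "lapmul A X" X] by (simp add: E_def inner_commute)
  finally show ?thesis
    by (simp add: E_def)
qed

end

locale consensus_problem = laplacian_spectrum A rho
  for A :: "real ^ 'n ^ 'n" and rho +
  fixes f :: "'n \<Rightarrow> 'a::euclidean_space \<Rightarrow> real" and grad :: "'n \<Rightarrow> 'a \<Rightarrow> 'a"
    and mu L :: real and ws :: 'a and gstar :: real
  assumes muL: "0 < mu" "mu \<le> L"
    and f_grad: "\<And>i x. (f i has_derivative (\<lambda>h. grad i x \<bullet> h)) (at x)"
    and f_strong: "\<And>i. strongly_convex_on UNIV mu (f i)"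
    and f_smooth: "\<And>i. L-lipschitz_on UNIV (grad i)"
    and ws_min: "\<And>w. (\<Sum>i\<in>UNIV. f i ws) \<le> (\<Sum>i\<in>UNIV. f i w)"
    and gstar: "\<And>i. norm (grad i ws) \<le> gstar"
begin

section \<open>The stacked gradient of the local objectives\<close>

definition Fg :: "'a ^ 'n \<Rightarrow> 'a ^ 'n" where
  "Fg X = (\<chi> i. grad i (X $ i))"

lemma gradG_eq: "gradG grad A gam eta X = Fg X + (gam / eta) *\<^sub>R lapmul A X"
  by (simp add: gradG_def Fg_def)

lemma continuous_on_Fg [continuous_intros]:
  assumes "continuous_on S g"
  shows "continuous_on S (\<lambda>x. Fg (g x))"
proof -
  have "continuous_on UNIV (grad i)" for i
    using f_smooth lipschitz_on_continuous_on by blast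
  then have "continuous_on S (\<lambda>x. grad i (g x $ i))" for i
    by (rule continuous_on_compose2) (auto intro!: continuous_intros assms)
  then show ?thesis
    unfolding Fg_def by (intro continuous_intros)
qed

lemma continuous_on_gradG [continuous_intros]:
  assumes "continuous_on S g"
  shows "continuous_on S (\<lambda>x. gradG grad A gam eta (g x))"
  unfolding gradG_eq by (intro continuous_intros assms)

lemma Fg_cocoercive:
  defines "D \<equiv> \<lambda>X Y. Fg Y - Fg X - mu *\<^sub>R (Y - X)"
  shows "(norm (D X Y))\<^sup>2 \<le> (L - mu) * (D X Y \<bullet> (Y - X))" "0 \<le> D X Y \<bullet> (Y - X)"
  using muL shifted_gradient_cocoercive[OF f_grad f_strong f_smooth]
  by (auto simp: D_def Fg_def norm_power2_eq_sum_vec inner_vec_def sum_distrib_left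
      intro!: sum_mono sum_nonneg)

lemma Fg_monotone: "mu * (norm (Y - X))\<^sup>2 \<le> (Fg Y - Fg X) \<bullet> (Y - X)"
  using Fg_cocoercive(2)[of Y X] by (simp add: inner_diff_left power2_norm_eq_inner)

lemma Fg_lipschitz: "norm (Fg Y - Fg X) \<le> L * norm (Y - X)"
proof (rule power2_le_imp_le)
  have "(norm (Fg Y - Fg X))\<^sup>2 \<le> (\<Sum>i\<in>UNIV. (L * norm (Y $ i - X $ i))\<^sup>2)"
    using f_smooth by (auto simp: Fg_def norm_power2_eq_sum_vec lipschitz_on_def dist_norm intro!: sum_mono power_mono)
  also have "\<dots> = (L * norm (Y - X))\<^sup>2"
    by (simp add: power_mult_distrib norm_power2_eq_sum_vec sum_distrib_left)
  finally show "(norm (Fg Y - Fg X))\<^sup>2 \<le> (L * norm (Y - X))\<^sup>2" .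
qed (use muL in auto)

lemma sum_grad_ws: "(\<Sum>i\<in>UNIV. grad i ws) = 0"
proof -
  have "((\<lambda>w. \<Sum>i\<in>UNIV. f i w) has_derivative (\<lambda>h. \<Sum>i\<in>UNIV. grad i ws \<bullet> h)) (at ws)"
    by (intro has_derivative_sum f_grad)
  then have "(\<lambda>h. \<Sum>i\<in>UNIV. grad i ws \<bullet> h) = (\<lambda>h. 0)"
    using differential_zero_maxmin[of ws UNIV] ws_min by blast
  then have "(\<Sum>i\<in>UNIV. grad i ws) \<bullet> h = 0" for h
    by (simp add: inner_sum_left fun_eq_iff)
  then show ?thesis
    by (metis inner_eq_zero_iff)
qed

lemma sum_Fg_vec_ws [simp]: "(\<Sum>i\<in>UNIV. Fg (vec ws) $ i) = 0"
  by (simp add: Fg_def sum_grad_ws)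

lemma norm_Fg_vec_ws: "norm (Fg (vec ws)) \<le> sqrt (real CARD('n)) * gstar"
  using gstar order_trans[OF norm_ge_zero gstar] by (intro norm_vec_le) (auto simp: Fg_def)

lemma gstar_nonneg: "0 \<le> gstar"
  using order_trans[OF norm_ge_zero gstar] .

section \<open>Contraction of the gradient step and its fixed point\<close>

lemma step_mu_le_1:
  assumes "0 < gam" "0 < eta" "eta * (mu + L) + gam * rho (CARD('n)) \<le> 2"
  shows "eta * mu \<le> 1"
proof -
  have "eta * (2 * mu) \<le> eta * (mu + L)"
    using muL assms by (intro mult_left_mono) auto
  moreover have "0 \<le> gam * rho (CARD('n))"
    using assms rho_last_pos by simp
  ultimately have "eta * (2 * mu) \<le> 2"
    using assms by linarith
  then show ?thesis
    by simp
qed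

text \<open>The gradient difference splits into \<open>mu *\<^sub>R Z\<close>, the remainder
  \<open>D\<close> of the local gradients and the Laplacian part \<open>B\<close>. Both
  \<open>D\<close> and \<open>B\<close> are cocoercive, so \<open>D + B\<close> is cocoercive with
  the sum of the two constants, and the step size condition is what makes its contribution to the
  squared norm nonpositive.\<close>

lemma gradient_step_contraction:
  assumes pos: "0 < gam" "0 < eta" and step: "eta * (mu + L) + gam * rho (CARD('n)) \<le> 2"
  shows "norm ((Y - eta *\<^sub>R gradG grad A gam eta Y) - (X - eta *\<^sub>R gradG grad A gam eta X))
    \<le> (1 - eta * mu) * norm (Y - X)"
proof (rule power2_le_imp_le)
  define Z where "Z = Y - X"
  define D where "D = Fg Y - Fg X - mu *\<^sub>R Z"
  define r where "r = gam / eta"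
  define B where "B = r *\<^sub>R lapmul A Z"
  have r: "r > 0"
    using pos by (simp add: r_def)
  define rN where "rN = rho (CARD('n))"
  have rN: "rN > 0"
    using rho_last_pos by (simp add: rN_def)
  have D: "(norm D)\<^sup>2 \<le> (L - mu) * (D \<bullet> Z)" "0 \<le> D \<bullet> Z"
    using Fg_cocoercive[of Y X] by (auto simp: D_def Z_def)
  have "(norm B)\<^sup>2 = r\<^sup>2 * (norm (lapmul A Z))\<^sup>2"
    by (simp add: B_def power_mult_distrib)
  also have "\<dots> \<le> r\<^sup>2 * (rN * (Z \<bullet> lapmul A Z))"
    unfolding rN_def by (intro mult_left_mono lapmul_cocoercive) auto
  finally have B: "(norm B)\<^sup>2 \<le> (r * rN) * (B \<bullet> Z)" "0 \<le> B \<bullet> Z"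
    using r lapmul_nonneg[of Z] by (auto simp: B_def inner_commute power2_eq_square mult_ac)
  have four_mult_le: "4 * (u * v) \<le> (u + v)\<^sup>2" for u v :: real
    using zero_le_power2[of "u - v"] by (simp add: power2_eq_square algebra_simps)
  have "(2 * (D \<bullet> B))\<^sup>2 \<le> 4 * ((norm D)\<^sup>2 * (norm B)\<^sup>2)"
    using Cauchy_Schwarz_ineq[of D B] by (simp add: power_mult_distrib power2_norm_eq_inner)
  also have "\<dots> \<le> 4 * (((L - mu) * (D \<bullet> Z)) * ((r * rN) * (B \<bullet> Z)))"
    using D B muL r rN by (intro mult_left_mono mult_mono) auto
  \<comment> \<open>Exchanging \<open>D \<bullet> Z\<close> and \<open>B \<bullet> Z\<close> before
    the arithmetic-geometric mean inequality yields exactly the two mixed terms missing from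
    \<open>(L - mu + r * rN) * ((D + B) \<bullet> Z)\<close>.\<close>
  also have "\<dots> = 4 * (((L - mu) * (B \<bullet> Z)) * ((r * rN) * (D \<bullet> Z)))"
    by (simp add: mult_ac)
  also have "\<dots> \<le> ((L - mu) * (B \<bullet> Z) + (r * rN) * (D \<bullet> Z))\<^sup>2"
    by (rule four_mult_le)
  finally have "2 * (D \<bullet> B) \<le> (L - mu) * (B \<bullet> Z) + (r * rN) * (D \<bullet> Z)"
    by (rule power2_le_imp_le) (use D B muL r rN in auto)
  then have DB: "(norm (D + B))\<^sup>2 \<le> (L - mu + r * rN) * ((D + B) \<bullet> Z)"
    using D B unfolding power2_norm_eq_inner by (simp add: algebra_simps inner_commute)
  have "(Y - eta *\<^sub>R gradG grad A gam eta Y) - (X - eta *\<^sub>R gradG grad A gam eta X)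
      = (1 - eta * mu) *\<^sub>R Z - eta *\<^sub>R (D + B)"
    by (simp add: gradG_eq Z_def D_def B_def r_def lapmul_diff algebra_simps)
  also have "(norm \<dots>)\<^sup>2 = ((1 - eta * mu) * norm Z)\<^sup>2 - 2 * eta * (1 - eta * mu) * ((D + B) \<bullet> Z)
      + eta * (eta * (norm (D + B))\<^sup>2)"
    unfolding power_mult_distrib power2_norm_eq_inner
    by (simp add: inner_diff_left inner_diff_right inner_commute power2_eq_square algebra_simps)
  also have "\<dots> \<le> ((1 - eta * mu) * norm Z)\<^sup>2 - 2 * eta * (1 - eta * mu) * ((D + B) \<bullet> Z)
      + eta * (eta * ((L - mu + r * rN) * ((D + B) \<bullet> Z)))"
    using DB pos by (intro add_left_mono mult_left_mono) auto
  \<comment> \<open>Collecting the terms in \<open>(D + B) \<bullet> Z\<close> exposes the slack in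
    the step size condition.\<close>
  also have "\<dots> = ((1 - eta * mu) * norm Z)\<^sup>2
      - eta * (2 - (eta * (mu + L) + gam * rN)) * ((D + B) \<bullet> Z)"
    using pos by (simp add: r_def field_simps)
  also have "\<dots> \<le> ((1 - eta * mu) * norm Z)\<^sup>2"
    using step pos D B by (simp add: rN_def inner_add_left)
  finally show "(norm ((Y - eta *\<^sub>R gradG grad A gam eta Y) - (X - eta *\<^sub>R gradG grad A gam eta X)))\<^sup>2
      \<le> ((1 - eta * mu) * norm (Y - X))\<^sup>2"
    by (simp add: Z_def)
  show "0 \<le> (1 - eta * mu) * norm (Y - X)"
    using step_mu_le_1[OF assms] by simp
qed

text \<open>The gradient step is a strict contraction of the whole space, and a fixed point of it
  has zero gradient because \<open>eta\<close> is nonzero.\<close>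

lemma stationary_point_exists:
  assumes pos: "0 < gam" "0 < eta" and step: "eta * (mu + L) + gam * rho (CARD('n)) \<le> 2"
  obtains Z where "gradG grad A gam eta Z = 0"
proof -
  have "\<exists>!Z. Z - eta *\<^sub>R gradG grad A gam eta Z = Z"
    using gradient_step_contraction[OF assms] step_mu_le_1[OF assms] muL pos
    by (intro banach_fix_type[of "1 - eta * mu"]) (auto simp: dist_norm)
  then obtain Z where "Z - eta *\<^sub>R gradG grad A gam eta Z = Z"
    by blast
  then show thesis
    using pos that[of Z] by simp
qed

text \<open>Strong convexity handles the local objectives and nonnegativity of the Laplacian form at
  \<open>Y - Z\<close> the penalty; stationarity cancels the two linear terms.\<close>

lemma Gfun_ge_stationary:
  assumes pos: "0 < gam" "0 < eta" and Z: "gradG grad A gam eta Z = 0"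
  shows "Gfun f A gam eta Z + mu / 2 * (norm (Y - Z))\<^sup>2 \<le> Gfun f A gam eta Y"
proof -
  define r where "r = gam / eta"
  have "(\<Sum>i\<in>UNIV. f i (Z $ i) + grad i (Z $ i) \<bullet> (Y $ i - Z $ i) + mu / 2 * (norm (Y $ i - Z $ i))\<^sup>2)
      \<le> (\<Sum>i\<in>UNIV. f i (Y $ i))"
    by (intro sum_mono strongly_convex_gradient_lower_bound f_strong f_grad)
  then have 1: "fstack f Z + Fg Z \<bullet> (Y - Z) + mu / 2 * (norm (Y - Z))\<^sup>2 \<le> fstack f Y"
    by (simp add: fstack_def Fg_def inner_vec_def norm_power2_eq_sum_vec sum.distrib sum_distrib_left)
  have Fg: "Fg Z = - (r *\<^sub>R lapmul A Z)"
    using Z by (simp add: gradG_eq r_def eq_neg_iff_add_eq_0)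
  have "0 \<le> r / 2 * ((Y - Z) \<bullet> lapmul A (Y - Z))"
    using pos lapmul_nonneg[of "Y - Z"] by (simp add: r_def)
  also have "\<dots> = r / 2 * (Y \<bullet> lapmul A Y) - r / 2 * (Z \<bullet> lapmul A Z) + Fg Z \<bullet> (Y - Z)"
    using lapmul_adj[of Y Z] unfolding Fg
    by (simp add: lapmul_diff inner_diff_left inner_diff_right algebra_simps inner_commute)
  finally show ?thesis
    using 1 by (simp add: Gfun_def r_def)
qed

text \<open>Since \<open>arg_min_on\<close> is a choice operator, it is identified by uniqueness of
  the minimiser, which the quadratic growth at \<open>Z\<close> supplies.\<close>

lemma arg_min_on_eq_stationary:
  assumes "0 < gam" "0 < eta" "gradG grad A gam eta Z = 0" and Z: "Z \<in> WN S"
  shows "arg_min_on (Gfun f A gam eta) (WN S) = Z"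
proof -
  note ge = Gfun_ge_stationary[OF assms(1-3)]
  have "is_arg_min (Gfun f A gam eta) (\<lambda>X. X \<in> WN S) Z"
    using Z ge muL unfolding is_arg_min_linorder
    by (smt (verit, best) mult_nonneg_nonneg zero_le_power2 divide_nonneg_nonneg)
  moreover have "X = Z" if "is_arg_min (Gfun f A gam eta) (\<lambda>X. X \<in> WN S) X" for X
  proof -
    have "mu / 2 * (norm (X - Z))\<^sup>2 \<le> 0"
      using that Z ge[of X] unfolding is_arg_min_linorder by force
    then show ?thesis
      using muL by (simp add: mult_le_0_iff)
  qed
  ultimately show ?thesis
    unfolding arg_min_on_def arg_min_def by (rule some_equality)
qed

section \<open>Distance to consensus and drift of stationary points\<close>

lemma sum_Fg_stationary:
  assumes "gradG grad A gam eta Z = 0"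
  shows "(\<Sum>i\<in>UNIV. Fg Z $ i) = 0"
proof -
  have "Fg Z = - ((gam / eta) *\<^sub>R lapmul A Z)"
    using assms by (simp add: gradG_eq eq_neg_iff_add_eq_0)
  then show ?thesis
    by (simp add: sum_negf flip: scaleR_sum_right)
qed

text \<open>The gradient difference is orthogonal to the consensus space, so strong monotonicity
  along \<open>Y - X\<close> is paid for by the deviation of \<open>Y - X\<close> alone.\<close>

lemma norm_diff_le_deviation:
  assumes "(\<Sum>i\<in>UNIV. Fg X $ i) = 0" "(\<Sum>i\<in>UNIV. Fg Y $ i) = 0"
  shows "norm (Y - X) \<le> L / mu * norm (deviation (Y - X))"
proof (cases "Y = X")
  case False
  have "mu * (norm (Y - X))\<^sup>2 \<le> (Fg Y - Fg X) \<bullet> (Y - X)"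
    by (rule Fg_monotone)
  also have "\<dots> = (Fg Y - Fg X) \<bullet> deviation (Y - X)"
    using assms by (simp add: inner_deviation sum_subtractf)
  also have "\<dots> \<le> norm (Fg Y - Fg X) * norm (deviation (Y - X))"
    by (rule norm_cauchy_schwarz)
  also have "\<dots> \<le> (L * norm (Y - X)) * norm (deviation (Y - X))"
    by (intro mult_right_mono Fg_lipschitz) auto
  finally have "norm (Y - X) * (mu * norm (Y - X)) \<le> norm (Y - X) * (L * norm (deviation (Y - X)))"
    by (simp add: power2_eq_square mult_ac)
  then show ?thesis
    using False muL by (simp add: field_simps)
qed (use muL in auto)

text \<open>Pairing stationarity with \<open>X = Z - vec ws\<close> bounds the Laplacian energy of
  \<open>X\<close> through monotonicity by the gradient at \<open>vec ws\<close>, which sees only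
  the deviation. The gap \<open>rho 2\<close> then bounds the deviation, and
  \<open>norm_diff_le_deviation\<close> the full distance at the cost of
  \<open>L / mu\<close>.\<close>

lemma stationary_dist_consensus:
  assumes pos: "0 < gam" "0 < eta" and Z: "gradG grad A gam eta Z = 0"
  shows "norm (Z - vec ws) \<le> sqrt (real CARD('n)) * gstar * L / (mu * rho 2) * (eta / gam)"
proof -
  define r where "r = gam / eta"
  have r: "r > 0"
    using pos by (simp add: r_def)
  define X where "X = Z - vec ws"
  define E where "E = deviation X"
  have Fg: "Fg Z = - (r *\<^sub>R lapmul A Z)"
    using Z by (simp add: gradG_eq r_def eq_neg_iff_add_eq_0)
  have "lapmul A Z = lapmul A X"
    by (simp add: X_def lapmul_diff)
  then have "r * (X \<bullet> lapmul A X) = - (Fg Z \<bullet> X)"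
    by (simp add: Fg inner_commute)
  also have "\<dots> \<le> - (Fg (vec ws) \<bullet> X)"
    using Fg_monotone[of Z "vec ws"] muL unfolding X_def
    by (smt (verit, best) inner_diff_left mult_nonneg_nonneg zero_le_power2)
  also have "\<dots> = - (Fg (vec ws) \<bullet> E)"
    by (simp add: E_def inner_deviation)
  also have "\<dots> \<le> norm (Fg (vec ws)) * norm E"
    using norm_cauchy_schwarz[of "- Fg (vec ws)" E] by simp
  also have "\<dots> \<le> (sqrt (real CARD('n)) * gstar) * norm E"
    by (intro mult_right_mono norm_Fg_vec_ws) auto
  finally have "r * (X \<bullet> lapmul A X) \<le> (sqrt (real CARD('n)) * gstar) * norm E" .
  moreover have "r * (rho 2 * (norm E)\<^sup>2) \<le> r * (X \<bullet> lapmul A X)"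
    unfolding E_def using r by (intro mult_left_mono lapmul_ge_deviation) auto
  ultimately have "norm E * (r * rho 2 * norm E) \<le> norm E * (sqrt (real CARD('n)) * gstar)"
    by (simp add: power2_eq_square mult_ac)
  then have "norm E \<le> sqrt (real CARD('n)) * gstar / (r * rho 2)"
    using r rho2 gstar_nonneg by (cases "E = 0") (auto simp: field_simps)
  then have "L / mu * norm E \<le> L / mu * (sqrt (real CARD('n)) * gstar / (r * rho 2))"
    using muL by (intro mult_left_mono) auto
  also have "\<dots> = sqrt (real CARD('n)) * gstar * L / (mu * rho 2) * (eta / gam)"
    by (simp add: r_def mult_ac)
  finally show ?thesis
    using norm_diff_le_deviation[of "vec ws" Z] sum_Fg_stationary[OF Z] by (simp add: E_def X_def)
qed

text \<open>The difference of the two stationarity equations, paired with \<open>X = Z' - Z\<close>,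
  gives the same kind of energy estimate; now the driving term is the change of the penalty weight
  times \<open>Fg Z\<close>.\<close>

lemma stationary_drift:
  assumes pos: "0 < gam" "0 < eta" "0 < gam'" "0 < eta'" and le: "gam / eta \<le> gam' / eta'"
    and Z: "gradG grad A gam eta Z = 0" and Z': "gradG grad A gam' eta' Z' = 0"
  shows "norm (Z' - Z) \<le> sqrt (real CARD('n)) * gstar * L / (mu * rho 2)
      * (1 + L\<^sup>2 / (mu * rho 2) * (eta / gam)) * (eta / gam - eta' / gam')"
proof -
  define r r' where "r = gam / eta" and "r' = gam' / eta'"
  have r: "r > 0" "r' \<ge> r" "r' > 0"
    using pos le by (simp_all add: r_def r'_def)
  define X where "X = Z' - Z"
  define E where "E = deviation X"
  have Fg: "Fg Z = - (r *\<^sub>R lapmul A Z)" "Fg Z' = - (r' *\<^sub>R lapmul A Z')"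
    using Z Z' by (simp_all add: gradG_eq r_def r'_def eq_neg_iff_add_eq_0)
  have "Fg Z' - Fg Z = - (r' *\<^sub>R lapmul A X) - (r' - r) *\<^sub>R lapmul A Z"
    by (simp add: Fg X_def lapmul_diff algebra_simps)
  \<comment> \<open>Stationarity of \<open>Z\<close> trades its Laplacian term for
    \<open>Fg Z\<close>, whose norm can be bounded.\<close>
  also have "(r' - r) *\<^sub>R lapmul A Z = - (((r' - r) / r) *\<^sub>R Fg Z)"
    using r by (simp add: Fg(1))
  finally have "Fg Z' - Fg Z = - (r' *\<^sub>R lapmul A X) + ((r' - r) / r) *\<^sub>R Fg Z"
    by simp
  moreover have "0 \<le> (Fg Z' - Fg Z) \<bullet> X"
    using Fg_monotone[of Z' Z] muL unfolding X_def
    by (smt (verit, best) mult_nonneg_nonneg zero_le_power2)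
  ultimately have "r' * (X \<bullet> lapmul A X) \<le> (r' - r) / r * (Fg Z \<bullet> X)"
    by (simp add: inner_diff_right inner_add_left inner_commute)
  also have "\<dots> = (r' - r) / r * (Fg Z \<bullet> E)"
    using sum_Fg_stationary[OF Z] by (simp add: E_def inner_deviation)
  also have "\<dots> \<le> (r' - r) / r * (norm (Fg Z) * norm E)"
    using r by (intro mult_left_mono norm_cauchy_schwarz) auto
  finally have "r' * (X \<bullet> lapmul A X) \<le> (r' - r) / r * (norm (Fg Z) * norm E)" .
  moreover have "r' * (rho 2 * (norm E)\<^sup>2) \<le> r' * (X \<bullet> lapmul A X)"
    unfolding E_def using r by (intro mult_left_mono lapmul_ge_deviation) auto
  ultimately have "norm E * (r' * rho 2 * norm E) \<le> norm E * ((r' - r) / r * norm (Fg Z))"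
    by (simp add: power2_eq_square mult_ac)
  then have "r' * rho 2 * norm E \<le> (r' - r) / r * norm (Fg Z)"
    using r by (cases "E = 0") (auto intro: mult_left_le_imp_le simp del: times_divide_eq_left)
  then have "norm E \<le> (r' - r) / r * norm (Fg Z) / (r' * rho 2)"
    using r rho2 by (simp add: pos_le_divide_eq mult_ac)
  also have "\<dots> = (1 / r - 1 / r') * norm (Fg Z) / rho 2"
    using r rho2 by (simp add: field_simps)
  finally have E: "norm E \<le> (1 / r - 1 / r') * norm (Fg Z) / rho 2" .
  \<comment> \<open>Comparison with the gradient at \<open>vec ws\<close>; the distance between the
    two points contributes the factor \<open>1 + L^2 / (mu * rho 2) * (eta / gam)\<close>.\<close>
  have "norm (Fg Z) \<le> norm (Fg (vec ws)) + norm (Fg Z - Fg (vec ws))"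
    using norm_triangle_ineq[of "Fg (vec ws)" "Fg Z - Fg (vec ws)"] by simp
  also have "\<dots> \<le> sqrt (real CARD('n)) * gstar + L * norm (Z - vec ws)"
    by (intro add_mono norm_Fg_vec_ws Fg_lipschitz)
  also have "\<dots> \<le> sqrt (real CARD('n)) * gstar
      + L * (sqrt (real CARD('n)) * gstar * L / (mu * rho 2) * (eta / gam))"
    using muL by (intro add_left_mono mult_left_mono stationary_dist_consensus pos Z) auto
  also have "\<dots> = sqrt (real CARD('n)) * gstar * (1 + L\<^sup>2 / (mu * rho 2) * (eta / gam))"
    by (simp add: algebra_simps power2_eq_square)
  finally have FgZ: "norm (Fg Z) \<le> sqrt (real CARD('n)) * gstar * (1 + L\<^sup>2 / (mu * rho 2) * (eta / gam))" .
  have "norm X \<le> L / mu * norm E"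
    unfolding X_def E_def by (intro norm_diff_le_deviation sum_Fg_stationary[OF Z] sum_Fg_stationary[OF Z'])
  also have "\<dots> \<le> L / mu * ((1 / r - 1 / r') * norm (Fg Z) / rho 2)"
    using muL E by (intro mult_left_mono) auto
  also have "\<dots> = L / mu * (1 / r - 1 / r') / rho 2 * norm (Fg Z)"
    by simp
  also have "\<dots> \<le> L / mu * (1 / r - 1 / r') / rho 2
      * (sqrt (real CARD('n)) * gstar * (1 + L\<^sup>2 / (mu * rho 2) * (eta / gam)))"
    using muL r rho2 by (intro mult_left_mono FgZ) (auto simp: field_simps)
  also have "\<dots> = sqrt (real CARD('n)) * gstar * L / (mu * rho 2)
      * (1 + L\<^sup>2 / (mu * rho 2) * (eta / gam)) * (eta / gam - eta' / gam')"
    by (simp add: r_def r'_def)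
  finally show ?thesis
    by (simp add: X_def)
qed

end

section \<open>Scalar recursions and noise\<close>

text \<open>Follows from \<open>ln (1 + x) \<le> x\<close> and
  \<open>exp z \<ge> 1 + z\<close>.\<close>

lemma powr_minus_ge_linear:
  fixes x p :: real
  assumes "0 \<le> x" "0 \<le> p"
  shows "1 - p * x \<le> (1 + x) powr (- p)"
proof -
  have "1 - p * x \<le> 1 - p * ln (1 + x)"
    using assms ln_add_one_self_le_self[of x] by (simp add: mult_left_mono)
  also have "\<dots> \<le> exp (- p * ln (1 + x))"
    using exp_ge_add_one_self[of "- p * ln (1 + x)"] by simp
  finally show ?thesis
    using assms by (simp add: powr_def)
qed

text \<open>One step multiplies the scale by \<open>1 + x\<close> with
  \<open>x = dlt / (1 + dlt * real k)\<close>, so every power rate changes by a power of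
  \<open>1 + x\<close>.\<close>

lemma step_scale_Suc:
  fixes dlt :: real
  assumes "0 \<le> dlt"
  shows "(1 + dlt * real (Suc k)) powr a
    = (1 + dlt * real k) powr a * (1 + dlt / (1 + dlt * real k)) powr a"
proof -
  have "1 + dlt * real k > 0"
    using assms by (simp add: add_pos_nonneg)
  moreover from this have "1 + dlt * real (Suc k) = (1 + dlt * real k) * (1 + dlt / (1 + dlt * real k))"
    by (simp add: field_simps)
  ultimately show ?thesis
    using assms by (simp add: powr_mult)
qed

text \<open>The contraction removes at least a fraction \<open>5 / 4 * x\<close> per step. The first
  term of the bound decays just slowly enough for this; the terms in \<open>u\<close> and its square
  decay more slowly still, and the spare room absorbs the drift.\<close>

lemma tracking_recursion:
  fixes D y :: "nat \<Rightarrow> real" and dlt B C K d :: real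
  defines "s \<equiv> \<lambda>k. 1 + dlt * real k"
  defines "u \<equiv> \<lambda>k. s k powr (-1/4)"
  assumes dlt: "0 \<le> dlt" and nn: "0 \<le> B" "0 \<le> C" "0 \<le> d" and K: "1 / 3 \<le> K"
    and init: "D kb \<le> d"
    and y: "\<And>k. kb \<le> k \<Longrightarrow> 5 / 4 * (dlt / s k) \<le> y k" "\<And>k. kb \<le> k \<Longrightarrow> y k \<le> 1"
    and rec: "\<And>k. kb \<le> k \<Longrightarrow>
      D (Suc k) \<le> (1 - y k) * D k + C * (1 + B * u k) * (u k - u (Suc k))"
    and le: "kb \<le> k"
  shows "D k \<le> d * (s k / s kb) powr (-5/4) + K * C * (1 + B * u k) * u k"
  using le
proof (induction k rule: dec_induct)
  case base
  have "0 \<le> u kb" "s kb > 0"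
    using dlt by (simp_all add: u_def s_def add_pos_nonneg)
  then show ?case
    using init nn K by (auto intro!: add_increasing2)
next
  case (step k)
  define x where "x = dlt / s k"
  define p where "p = (1 + x) powr (-1/4)"
  define q where "q = (1 + x) powr (-5/4)"
  define v where "v = (s k / s kb) powr (-5/4)"
  have s: "s k > 0" "s kb > 0" "s (Suc k) > 0"
    using dlt by (simp_all add: s_def add_pos_nonneg)
  have x: "0 \<le> x"
    using dlt s by (simp add: x_def)
  have un: "0 \<le> u k" "0 \<le> v"
    by (simp_all add: u_def v_def)
  have uS: "u (Suc k) = u k * p"
    using step_scale_Suc[OF dlt, of k "-1/4"] by (simp add: u_def s_def p_def x_def)
  have vS: "(s (Suc k) / s kb) powr (-5/4) = v * q"
    using step_scale_Suc[OF dlt, of k "-5/4"] s by (simp add: s_def v_def q_def x_def powr_divide)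
  have p: "1 - x / 4 \<le> p"
    using powr_minus_ge_linear[OF x, of "1/4"] by (simp add: p_def)
  have "p * p = (1 + x) powr (-1/2)"
    by (simp add: p_def flip: powr_add)
  then have pp: "1 - x / 2 \<le> p * p"
    using powr_minus_ge_linear[OF x, of "1/2"] by simp
  have q: "1 - 5 / 4 * x \<le> q"
    using powr_minus_ge_linear[OF x, of "5/4"] by (simp add: q_def)
  \<comment> \<open>The drift costs at most \<open>x / 4\<close>. The spare room is
    \<open>K * x\<close> for the term in \<open>u\<close> and \<open>3 / 4 * K * x\<close> for the
    term in its square, the latter being the source of \<open>1 / 3 \<le> K\<close>.\<close>
  have Kx: "x \<le> 3 * (K * x)" "x \<le> 4 * (K * x)"
    using mult_right_mono[OF K x] x by (auto simp: algebra_simps)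
  have Kp: "K * (1 - x / 4) \<le> K * p" "K * (1 - x / 2) \<le> K * (p * p)"
    using K p pp by (auto intro!: mult_left_mono)
  have c: "K * (1 - 5 / 4 * x) + (1 - p) \<le> K * p" "K * (1 - 5 / 4 * x) + (1 - p) \<le> K * (p * p)"
    using p Kp Kx by (simp_all add: algebra_simps)
  define R where "R = d * v + K * C * (1 + B * u k) * u k"
  have R: "0 \<le> R"
    using nn un K by (simp add: R_def)
  have "D (Suc k) \<le> (1 - y k) * D k + C * (1 + B * u k) * (u k - u (Suc k))"
    using rec step by simp
  also have "(1 - y k) * D k \<le> (1 - y k) * R"
    using step y(2)[of k] by (intro mult_left_mono) (auto simp: R_def v_def)
  also have "(1 - y k) * R \<le> (1 - 5 / 4 * x) * R"
    using y(1)[of k] step R by (intro mult_right_mono) (auto simp: x_def)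
  \<comment> \<open>The summands \<open>1\<close> and \<open>B * u k\<close> are kept apart because
    their bounds shrink by \<open>p\<close> and by \<open>p * p\<close> respectively.\<close>
  also have "(1 - 5 / 4 * x) * R + C * (1 + B * u k) * (u k - u (Suc k))
      = d * v * (1 - 5 / 4 * x) + C * u k * (1 * (K * (1 - 5 / 4 * x) + (1 - p)))
        + C * u k * ((B * u k) * (K * (1 - 5 / 4 * x) + (1 - p)))"
    unfolding R_def uS by (simp add: algebra_simps)
  also have "\<dots> \<le> d * v * q + C * u k * (1 * (K * p)) + C * u k * ((B * u k) * (K * (p * p)))"
    using nn un by (intro add_mono mult_left_mono q c) auto
  also have "\<dots> = d * (s (Suc k) / s kb) powr (-5/4) + K * C * (1 + B * u (Suc k)) * u (Suc k)"
    unfolding uS vS by (simp add: algebra_simps)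
  finally show ?case
    by simp
qed

text \<open>One contraction factor is discarded through \<open>(1 - y)^2 \<le> 1 - y\<close>. The
  remaining one beats the decay of \<open>q\<close> by \<open>y / 5\<close>, so
  \<open>K \<ge> 5\<close> pays for the new noise.\<close>

lemma variance_recursion:
  fixes V y q :: "nat \<Rightarrow> real" and K :: real
  assumes K: "5 \<le> K" and init: "V kb \<le> 0"
    and y: "\<And>k. kb \<le> k \<Longrightarrow> 0 \<le> y k" "\<And>k. kb \<le> k \<Longrightarrow> y k \<le> 1"
    and q: "\<And>k. 0 \<le> q k" "\<And>k. kb \<le> k \<Longrightarrow> (1 - 4 / 5 * y k) * q k \<le> q (Suc k)"
    and rec: "\<And>k. kb \<le> k \<Longrightarrow> V (Suc k) \<le> (1 - y k)\<^sup>2 * V k + y k * q k"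
    and le: "kb \<le> k"
  shows "V k \<le> K * q k"
  using le
proof (induction k rule: dec_induct)
  case base
  then show ?case
    using init K q(1)[of kb] by (meson mult_nonneg_nonneg order_trans zero_le_numeral)
next
  case (step k)
  have yk: "0 \<le> y k" "y k \<le> 1"
    using y step by auto
  have yq: "0 \<le> y k * q k"
    using yk q(1) by simp
  have "V (Suc k) \<le> (1 - y k)\<^sup>2 * V k + y k * q k"
    using rec step by simp
  also have "(1 - y k)\<^sup>2 * V k \<le> (1 - y k)\<^sup>2 * (K * q k)"
    using step by (intro mult_left_mono) auto
  also have "\<dots> \<le> (1 - y k) * (K * q k)"
    using yk q(1) K by (intro mult_right_mono) (auto simp: power2_eq_square mult_left_le)
  also have "(1 - y k) * (K * q k) + y k * q k \<le> K * ((1 - 4 / 5 * y k) * q k)"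
    using mult_right_mono[OF K yq] by (simp add: algebra_simps)
  also have "\<dots> \<le> K * q (Suc k)"
    using K q(2) step by (intro mult_left_mono) auto
  finally show ?case
    by simp
qed

section \<open>Second moments of the noisy update\<close>

context prob_space
begin

text \<open>The vector-valued conditional mean is expressed by scalar ones, so the argument runs
  coordinate by coordinate over \<open>Basis\<close>.\<close>

lemma expectation_inner_cond_mean_zero:
  fixes X e :: "'a \<Rightarrow> 'b::euclidean_space"
  assumes sub: "subalgebra M F"
    and X: "X \<in> borel_measurable F" and bd: "\<And>w. w \<in> space M \<Longrightarrow> norm (X w) \<le> c"
    and e: "e \<in> borel_measurable M" "integrable M (\<lambda>w. (norm (e w))\<^sup>2)"
    and mean: "\<And>v. AE w in M. real_cond_exp M F (\<lambda>w. e w \<bullet> v) w = 0"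
  shows "integrable M (\<lambda>w. X w \<bullet> e w)" "expectation (\<lambda>w. X w \<bullet> e w) = 0"
proof -
  interpret finite_measure_subalgebra M F
    using sub by unfold_locales
  have Xm: "X \<in> borel_measurable M"
    using measurable_from_subalg[OF sub X] .
  have prod: "integrable M (\<lambda>w. (X w \<bullet> b) * (e w \<bullet> b))"
    "expectation (\<lambda>w. (X w \<bullet> b) * (e w \<bullet> b)) = 0" if b: "b \<in> Basis" for b
  proof -
    show int: "integrable M (\<lambda>w. (X w \<bullet> b) * (e w \<bullet> b))"
    proof (rule Bochner_Integration.integrable_bound[where f = "\<lambda>w. c\<^sup>2 + (norm (e w))\<^sup>2"])
      show "integrable M (\<lambda>w. c\<^sup>2 + (norm (e w))\<^sup>2)"
        using e by simp
      show "(\<lambda>w. (X w \<bullet> b) * (e w \<bullet> b)) \<in> borel_measurable M"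
        using Xm e by measurable
      have "\<bar>(X w \<bullet> b) * (e w \<bullet> b)\<bar> \<le> c\<^sup>2 + (norm (e w))\<^sup>2" if w: "w \<in> space M" for w
      proof -
        have "\<bar>(X w \<bullet> b) * (e w \<bullet> b)\<bar> \<le> c * norm (e w)"
          unfolding abs_mult using bd[OF w] Basis_le_norm[OF b, of "X w"] Basis_le_norm[OF b, of "e w"]
          by (intro mult_mono) auto
        also have "\<dots> \<le> 2 * (c * norm (e w))"
          using order_trans[OF norm_ge_zero bd[OF w]] by simp
        also have "\<dots> \<le> c\<^sup>2 + (norm (e w))\<^sup>2"
          using sum_squares_bound[of c "norm (e w)"] by simp
        finally show ?thesis .
      qed
      then show "AE w in M. norm ((X w \<bullet> b) * (e w \<bullet> b)) \<le> norm (c\<^sup>2 + (norm (e w))\<^sup>2)"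
        by (intro AE_I2) simp
    qed
    \<comment> \<open>The coordinate of \<open>X\<close> is \<open>F\<close>-measurable and can be
      taken out of the conditional expectation.\<close>
    have "expectation (\<lambda>w. (X w \<bullet> b) * (e w \<bullet> b))
        = expectation (\<lambda>w. (X w \<bullet> b) * real_cond_exp M F (\<lambda>w. e w \<bullet> b) w)"
      using X e by (intro real_cond_exp_intg(2)[symmetric] int borel_measurable_inner borel_measurable_const)
    also have "\<dots> = 0"
      using mean[of b] by (intro integral_eq_zero_AE) auto
    finally show "expectation (\<lambda>w. (X w \<bullet> b) * (e w \<bullet> b)) = 0" .
  qed
  have eq: "(\<lambda>w. X w \<bullet> e w) = (\<lambda>w. \<Sum>b\<in>Basis. (X w \<bullet> b) * (e w \<bullet> b))"
    by (rule ext) (rule euclidean_inner)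
  show "integrable M (\<lambda>w. X w \<bullet> e w)"
    unfolding eq by (intro Bochner_Integration.integrable_sum prod)
  show "expectation (\<lambda>w. X w \<bullet> e w) = 0"
    unfolding eq by (subst Bochner_Integration.integral_sum) (auto simp: prod)
qed

lemma integrable_inner_of_square:
  fixes a b :: "'a \<Rightarrow> 'b::euclidean_space"
  assumes "a \<in> borel_measurable M" "integrable M (\<lambda>w. (norm (a w))\<^sup>2)"
    and "b \<in> borel_measurable M" "integrable M (\<lambda>w. (norm (b w))\<^sup>2)"
  shows "integrable M (\<lambda>w. a w \<bullet> b w)"
proof (rule Bochner_Integration.integrable_bound[where f = "\<lambda>w. (norm (a w))\<^sup>2 + (norm (b w))\<^sup>2"])
  have "\<bar>a w \<bullet> b w\<bar> \<le> (norm (a w))\<^sup>2 + (norm (b w))\<^sup>2" for w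
  proof -
    have "\<bar>a w \<bullet> b w\<bar> \<le> norm (a w) * norm (b w)"
      by (rule Cauchy_Schwarz_ineq2)
    also have "\<dots> \<le> 2 * norm (a w) * norm (b w)"
      by simp
    also have "\<dots> \<le> (norm (a w))\<^sup>2 + (norm (b w))\<^sup>2"
      by (rule sum_squares_bound)
    finally show ?thesis .
  qed
  then show "AE w in M. norm (a w \<bullet> b w) \<le> norm ((norm (a w))\<^sup>2 + (norm (b w))\<^sup>2)"
    by (intro AE_I2) simp
qed (use assms in auto)

text \<open>After expanding the square, the cross terms with \<open>X\<close> vanish by the
  conditional means and the one between \<open>e1\<close> and \<open>e2\<close> by uncorrelatedness;
  the variances pass from conditional to total expectation.\<close>

lemma expectation_noisy_square_le:
  fixes X e1 e2 :: "'a \<Rightarrow> 'b::euclidean_space"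
  assumes sub: "subalgebra M F"
    and X: "X \<in> borel_measurable F" "\<And>w. w \<in> space M \<Longrightarrow> norm (X w) \<le> c"
    and e1: "e1 \<in> borel_measurable M" "integrable M (\<lambda>w. (norm (e1 w))\<^sup>2)"
      "\<And>v. AE w in M. real_cond_exp M F (\<lambda>w. e1 w \<bullet> v) w = 0"
      "AE w in M. real_cond_exp M F (\<lambda>w. (norm (e1 w))\<^sup>2) w \<le> S1"
    and e2: "e2 \<in> borel_measurable M" "integrable M (\<lambda>w. (norm (e2 w))\<^sup>2)"
      "\<And>v. AE w in M. real_cond_exp M F (\<lambda>w. e2 w \<bullet> v) w = 0"
      "AE w in M. real_cond_exp M F (\<lambda>w. (norm (e2 w))\<^sup>2) w \<le> S2"
    and uncorr: "AE w in M. real_cond_exp M F (\<lambda>w. e1 w \<bullet> e2 w) w = 0"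
  shows "integrable M (\<lambda>w. (norm (X w + g *\<^sub>R e1 w - h *\<^sub>R e2 w))\<^sup>2)"
    "expectation (\<lambda>w. (norm (X w + g *\<^sub>R e1 w - h *\<^sub>R e2 w))\<^sup>2)
      \<le> expectation (\<lambda>w. (norm (X w))\<^sup>2) + g\<^sup>2 * S1 + h\<^sup>2 * S2"
proof -
  interpret finite_measure_subalgebra M F
    using sub by unfold_locales
  note Xm = measurable_from_subalg[OF sub X(1)]
  have iX: "integrable M (\<lambda>w. (norm (X w))\<^sup>2)"
  proof (rule integrable_const_bound[where B = "c\<^sup>2"])
    show "AE w in M. norm ((norm (X w))\<^sup>2) \<le> c\<^sup>2"
      using X(2) by (intro AE_I2) (simp add: power_mono)
  qed (use Xm in measurable)
  note i1 = expectation_inner_cond_mean_zero[OF sub X e1(1,2,3)]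
  note i2 = expectation_inner_cond_mean_zero[OF sub X e2(1,2,3)]
  note i12 = integrable_inner_of_square[OF e1(1,2) e2(1,2)]
  have z12: "expectation (\<lambda>w. e1 w \<bullet> e2 w) = 0"
    unfolding real_cond_exp_int(2)[OF i12, symmetric] using uncorr by (intro integral_eq_zero_AE)
  have var: "expectation (\<lambda>w. (norm (e w))\<^sup>2) \<le> S"
    if "integrable M (\<lambda>w. (norm (e w))\<^sup>2)" "AE w in M. real_cond_exp M F (\<lambda>w. (norm (e w))\<^sup>2) w \<le> S"
    for e :: "'a \<Rightarrow> 'b" and S
  proof -
    have "expectation (\<lambda>w. (norm (e w))\<^sup>2) = expectation (real_cond_exp M F (\<lambda>w. (norm (e w))\<^sup>2))"
      using that(1) by (intro real_cond_exp_int(2)[symmetric])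
    also have "\<dots> \<le> expectation (\<lambda>w. S)"
      using that by (intro integral_mono_AE real_cond_exp_int) auto
    finally show ?thesis
      by (simp add: prob_space)
  qed
  have eq: "(norm (X w + g *\<^sub>R e1 w - h *\<^sub>R e2 w))\<^sup>2
      = (norm (X w))\<^sup>2 + g\<^sup>2 * (norm (e1 w))\<^sup>2 + h\<^sup>2 * (norm (e2 w))\<^sup>2
        + 2 * g * (X w \<bullet> e1 w) - 2 * h * (X w \<bullet> e2 w) - 2 * g * h * (e1 w \<bullet> e2 w)" for w
    unfolding power2_norm_eq_inner
    by (simp add: inner_add_left inner_add_right inner_diff_left inner_diff_right inner_commute
        power2_eq_square algebra_simps)
  show "integrable M (\<lambda>w. (norm (X w + g *\<^sub>R e1 w - h *\<^sub>R e2 w))\<^sup>2)"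
    unfolding eq by (intro Bochner_Integration.integrable_add Bochner_Integration.integrable_diff
        integrable_mult_right iX e1 e2 i1 i2 i12)
  have "expectation (\<lambda>w. (norm (X w + g *\<^sub>R e1 w - h *\<^sub>R e2 w))\<^sup>2)
      = expectation (\<lambda>w. (norm (X w))\<^sup>2) + g\<^sup>2 * expectation (\<lambda>w. (norm (e1 w))\<^sup>2)
        + h\<^sup>2 * expectation (\<lambda>w. (norm (e2 w))\<^sup>2)"
    unfolding eq using iX e1(2) e2(2) i1 i2 i12 z12 by simp
  also have "\<dots> \<le> expectation (\<lambda>w. (norm (X w))\<^sup>2) + g\<^sup>2 * S1 + h\<^sup>2 * S2"
    by (intro add_mono mult_left_mono order_refl var e1 e2) auto
  finally show "expectation (\<lambda>w. (norm (X w + g *\<^sub>R e1 w - h *\<^sub>R e2 w))\<^sup>2)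
      \<le> expectation (\<lambda>w. (norm (X w))\<^sup>2) + g\<^sup>2 * S1 + h\<^sup>2 * S2" .
qed

lemma Enorm_le_const:
  assumes "\<And>w. w \<in> space M \<Longrightarrow> norm (X w) \<le> c" "0 \<le> c"
  shows "Enorm M X \<le> c"
proof -
  have "expectation (\<lambda>w. (norm (X w))\<^sup>2) \<le> expectation (\<lambda>w. c\<^sup>2)"
    using assms by (intro integral_mono_AE') (auto intro!: AE_I2 power_mono)
  then show ?thesis
    using assms(2) by (simp add: Enorm_def prob_space real_le_lsqrt)
qed

end

section \<open>Convergence of the iterates\<close>

text \<open>A segment from \<open>x\<close> to a point outside \<open>S\<close> meets the frontier
  at a point strictly closer to \<open>x\<close>, so the outside point is farther away than the
  infimum.\<close>

lemma mem_of_dist_le_frontier: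
  fixes S :: "'a::real_normed_vector set"
  assumes "closed S" "x \<in> S" and le: "norm (w - x) \<le> Inf ((\<lambda>w. norm (w - x)) ` frontier S)"
  shows "w \<in> S"
proof (rule ccontr)
  assume w: "w \<notin> S"
  then have "closed_segment x w \<inter> frontier S \<noteq> {}"
    using assms(2) by (intro connected_Int_frontier) auto
  then obtain p where p: "p \<in> closed_segment x w" "p \<in> frontier S"
    by blast
  then obtain t where t: "0 \<le> t" "t \<le> 1" "p = (1 - t) *\<^sub>R x + t *\<^sub>R w"
    by (auto simp: in_segment)
  \<comment> \<open>Closedness puts the frontier inside \<open>S\<close>; this strictness allows
    equality in the distance hypothesis.\<close>
  have "p \<noteq> w"
    using p(2) w assms(1) frontier_subset_closed by blast
  then have "t < 1"
    using t by (cases "t = 1") auto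
  have "norm (p - x) = t * norm (w - x)"
  proof -
    have "p - x = t *\<^sub>R (w - x)"
      by (simp add: t algebra_simps)
    then show ?thesis
      using t by simp
  qed
  also have "\<dots> < 1 * norm (w - x)"
    using \<open>t < 1\<close> w assms(2) by (intro mult_strict_right_mono) auto
  also have "\<dots> \<le> norm (p - x)"
    unfolding mult_1 using p(2) by (intro order_trans[OF le] cInf_lower bdd_belowI[of _ 0]) auto
  finally show False
    by simp
qed

section \<open>Projection onto the product set\<close>

lemma closed_WN:
  assumes "closed S"
  shows "closed (WN S :: ('a::topological_space ^ 'n) set)"
  unfolding WN_def
  by (intro closed_Collect_all) (auto intro!: closed_vimage[OF assms, unfolded vimage_def] continuous_intros)

lemma convex_WN: "convex S \<Longrightarrow> convex (WN S)"
  by (auto simp: WN_def convex_def)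

lemma WN_nonempty:
  assumes "S \<noteq> {}"
  shows "WN S \<noteq> {}"
proof -
  obtain x where "x \<in> S"
    using assms by blast
  then have "vec x \<in> WN S"
    by (simp add: WN_def)
  then show ?thesis
    by blast
qed

lemma projN_in: "closed S \<Longrightarrow> S \<noteq> {} \<Longrightarrow> projN S X \<in> WN S"
  unfolding projN_def by (intro closest_point_in_set closed_WN WN_nonempty)

lemma projN_nonexpansive:
  assumes "closed S" "convex S" "S \<noteq> {}"
  shows "norm (projN S X - projN S Y) \<le> norm (X - Y)"
  using closest_point_lipschitz[of "WN S" X Y] closed_WN[of S] convex_WN[of S] WN_nonempty[of S] assms
  by (simp add: projN_def dist_norm)

lemma projN_self: "X \<in> WN S \<Longrightarrow> projN S X = X"
  by (simp add: projN_def closest_point_self)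

lemma continuous_on_projN:
  assumes "closed S" "convex S" "S \<noteq> {}"
  shows "continuous_on UNIV (projN S)"
  unfolding projN_def[abs_def] using assms
  by (intro continuous_on_closest_point closed_WN convex_WN WN_nonempty)

lemma norm_WN_diff_le:
  fixes X Y :: "'a::real_inner ^ 'n"
  assumes "bounded S" "X \<in> WN S" "Y \<in> WN S"
  shows "norm (X - Y) \<le> sqrt (real CARD('n)) * diameter S"
proof (rule norm_vec_le)
  show "norm ((X - Y) $ i) \<le> diameter S" for i
    using diameter_bounded_bound[OF assms(1), of "X $ i" "Y $ i"] assms(2,3)
    by (simp add: WN_def dist_norm)
qed (use assms(1) in \<open>simp add: diameter_ge_0\<close>)

theorem theorem2:
  fixes f :: "'n::finite \<Rightarrow> 'a::euclidean_space \<Rightarrow> real"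
    and grad :: "'n \<Rightarrow> 'a \<Rightarrow> 'a"
    and mu L :: real
    and ws :: 'a
    and Wset :: "'a set"
    and zeta dmW gstar :: real
    and Lp :: "real ^ 'n ^ 'n"
    and rho :: "nat \<Rightarrow> real"
    and M :: "'w measure"
    and Fil :: "nat \<Rightarrow> 'w measure"
    and kb :: nat
    and W Wb eps1 eps2 :: "nat \<Rightarrow> 'w \<Rightarrow> 'a ^ 'n"
    and Sig1 Sig2 gam0 eta0 dlt :: real
  assumes N2: "CARD('n) \<ge> 2"
    and muL: "0 < mu" "mu \<le> L"
    and f_grad: "\<And>i x. (f i has_derivative (\<lambda>h. grad i x \<bullet> h)) (at x)"
    and f_strong: "\<And>i. strongly_convex_on UNIV mu (f i)"
    and f_smooth: "\<And>i. L-lipschitz_on UNIV (grad i)"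
    and ws_min: "\<And>w. (\<Sum>i\<in>UNIV. f i ws) / real CARD('n) \<le> (\<Sum>i\<in>UNIV. f i w) / real CARD('n)"
    and W_set: "Wset \<noteq> {}" "closed Wset" "convex Wset" "bounded Wset" "ws \<in> interior Wset"
    and zeta_def: "zeta = Inf ((\<lambda>w. norm (w - ws)) ` frontier Wset)"
    and zeta_pos: "zeta > 0"
    and dmW_def: "dmW = diameter Wset"
    and gstar_def: "gstar = Max ((\<lambda>i. norm (grad i ws)) ` UNIV)"
    and Lp_sym: "transpose Lp = Lp"
    and Lp_offdiag: "\<And>i j. i \<noteq> j \<Longrightarrow> Lp $ i $ j \<le> 0"
    and Lp_row: "Lp *v vec 1 = 0"
    and rho_eig: "\<And>x::real. det (x *\<^sub>R mat 1 - Lp) = (\<Prod>j\<in>{1..CARD('n)}. x - rho j)"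
    and rho_sorted: "\<And>j. 1 \<le> j \<Longrightarrow> j < CARD('n) \<Longrightarrow> rho j \<le> rho (Suc j)"
    and rho_1: "rho 1 = 0"
    and rho_2: "rho 2 > 0"
    and prob: "prob_space M"
    and filt_sub: "\<And>k. subalgebra M (Fil k)"
    and filt_mono: "\<And>k. sets (Fil k) \<subseteq> sets (Fil (Suc k))"
    and W_init_meas: "W kb \<in> borel_measurable (Fil kb)"
    and W_init_set: "\<And>\<omega>. \<omega> \<in> space M \<Longrightarrow> W kb \<omega> \<in> WN Wset"
    and W_step: "\<And>k \<omega>. kb \<le> k \<Longrightarrow> \<omega> \<in> space M \<Longrightarrow>
        W (Suc k) \<omega> = projN Wset (W k \<omega> - eta_k eta0 dlt k *\<^sub>R gradG grad Lp (gam_k gam0 dlt k) (eta_k eta0 dlt k) (W k \<omega>)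
                      + gam_k gam0 dlt k *\<^sub>R eps1 k \<omega> - eta_k eta0 dlt k *\<^sub>R eps2 k \<omega>)"
    and eps1_meas: "\<And>k. kb \<le> k \<Longrightarrow> eps1 k \<in> borel_measurable (Fil (Suc k))"
    and eps2_meas: "\<And>k. kb \<le> k \<Longrightarrow> eps2 k \<in> borel_measurable (Fil (Suc k))"
    and eps1_int: "\<And>k. kb \<le> k \<Longrightarrow> integrable M (\<lambda>\<omega>. (norm (eps1 k \<omega>))\<^sup>2)"
    and eps2_int: "\<And>k. kb \<le> k \<Longrightarrow> integrable M (\<lambda>\<omega>. (norm (eps2 k \<omega>))\<^sup>2)"
    and eps1_mean: "\<And>k v. kb \<le> k \<Longrightarrow> AE \<omega> in M. real_cond_exp M (Fil k) (\<lambda>\<omega>. eps1 k \<omega> \<bullet> v) \<omega> = 0"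
    and eps2_mean: "\<And>k v. kb \<le> k \<Longrightarrow> AE \<omega> in M. real_cond_exp M (Fil k) (\<lambda>\<omega>. eps2 k \<omega> \<bullet> v) \<omega> = 0"
    and eps_uncorr: "\<And>k. kb \<le> k \<Longrightarrow> AE \<omega> in M. real_cond_exp M (Fil k) (\<lambda>\<omega>. eps1 k \<omega> \<bullet> eps2 k \<omega>) \<omega> = 0"
    and eps1_var: "\<And>k. kb \<le> k \<Longrightarrow> AE \<omega> in M.
        real_cond_exp M (Fil k) (\<lambda>\<omega>. (norm (eps1 k \<omega>))\<^sup>2) \<omega> / real CARD('n) \<le> Sig1"
    and eps2_var: "\<And>k. kb \<le> k \<Longrightarrow> AE \<omega> in M.
        real_cond_exp M (Fil k) (\<lambda>\<omega>. (norm (eps2 k \<omega>))\<^sup>2) \<omega> / real CARD('n) \<le> Sig2"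
    and Sig_nonneg: "Sig1 \<ge> 0" "Sig2 \<ge> 0"
    and Wb_init: "Wb kb = W kb"
    and Wb_step: "\<And>k \<omega>. kb \<le> k \<Longrightarrow>
        Wb (Suc k) \<omega> = projN Wset (Wb k \<omega> - eta_k eta0 dlt k *\<^sub>R gradG grad Lp (gam_k gam0 dlt k) (eta_k eta0 dlt k) (Wb k \<omega>))"
    and par_pos: "gam0 > 0" "eta0 > 0" "dlt > 0" "dlt \<le> 4/5 * mu * eta0"
    and step_cond1: "\<And>k. kb \<le> k \<Longrightarrow> eta_k eta0 dlt k * (mu + L) + gam_k gam0 dlt k * rho (CARD('n)) \<le> 2"
    and step_cond2: "\<And>k. kb \<le> k \<Longrightarrow>
        eta_k eta0 dlt k / gam_k gam0 dlt k * (sqrt (real CARD('n)) * gstar * L) \<le> zeta * mu * rho 2"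
  shows "\<forall>k\<ge>kb.
     1 / sqrt (real CARD('n)) * Enorm M (\<lambda>\<omega>. W k \<omega> - Wb k \<omega>)
        \<le> sqrt 5 * exp 1 / (2 * sqrt mu) *
           (gam0 / sqrt eta0 * sqrt Sig1 + sqrt (eta0 * Sig2) * (1 + dlt * real k) powr (-1/4))
           * (1 + dlt * real k) powr (-1/4)
   \<and> 1 / sqrt (real CARD('n)) *
       Enorm M (\<lambda>\<omega>. Wb k \<omega> - arg_min_on (Gfun f Lp (gam_k gam0 dlt k) (eta_k eta0 dlt k)) (WN Wset))
        \<le> dmW * (1 + dlt * (real k - real kb) / (1 + dlt * real kb)) powr (-5/4)
          + gstar * L / (mu * rho 2) * (exp 1 / 4) * (eta0 / gam0)
            * (1 + L\<^sup>2 / (mu * rho 2) * (eta0 / gam0) * (1 + dlt * real k) powr (-1/4))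
            * (1 + dlt * real k) powr (-1/4)
   \<and> 1 / sqrt (real CARD('n)) *
       norm (arg_min_on (Gfun f Lp (gam_k gam0 dlt k) (eta_k eta0 dlt k)) (WN Wset) - vec ws)
        \<le> gstar * L / (mu * rho 2) * (eta0 / gam0) * (1 + dlt * real k) powr (-1/4)"
proof -

  \<comment> \<open>Step sizes and their ratio\<close>
  define N where "N = real CARD('n)"
  define s where "s k = 1 + dlt * real k" for k
  define u where "u k = s k powr (-1/4)" for k
  define eta where "eta k = eta_k eta0 dlt k" for k
  define gam where "gam k = gam_k gam0 dlt k" for k
  define G where "G k = gradG grad Lp (gam k) (eta k)" for k
  interpret consensus_problem Lp rho f grad mu L ws gstar
  proof unfold_locales
    show "(\<Sum>i\<in>UNIV. f i ws) \<le> (\<Sum>i\<in>UNIV. f i w)" for w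
      using ws_min[of w] by (simp add: divide_le_cancel)
    show "norm (grad i ws) \<le> gstar" for i
      unfolding gstar_def by (intro Max_ge) auto
  qed (use assms in \<open>auto simp del: vec_1\<close>)
  interpret prob_space M
    by (rule prob)
  have N: "0 < N"
    using N2 by (simp add: N_def)
  have s: "0 < s k" for k
    using par_pos by (simp add: s_def add_pos_nonneg)
  have u: "0 < u k" for k
    using s[of k] by (simp add: u_def)
  have u2: "u k * u k = s k powr (-1/2)" for k
    by (simp add: u_def flip: powr_add)
  have eta_eq: "eta k = eta0 / s k" for k
    using s[of k] by (simp add: eta_def eta_k_def s_def powr_minus_divide)
  have eta: "0 < eta k" and gam: "0 < gam k" for k
    using s[of k] par_pos by (auto simp: eta_eq gam_def gam_k_def s_def[symmetric])
  \<comment> \<open>The exponents \<open>-1\<close> and \<open>-3/4\<close> leave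
    \<open>-1/4\<close>, the rate of the penalty bias and hence of all terms driven by it.\<close>
  have ratio: "eta k / gam k = eta0 / gam0 * u k" for k
  proof -
    have "eta k / gam k = eta0 / gam0 * (s k powr (-1) / s k powr (-3/4))"
      by (simp add: eta_def gam_def eta_k_def gam_k_def s_def)
    also have "s k powr (-1) / s k powr (-3/4) = u k"
      using powr_diff[of "s k" "-1" "-3/4"] by (simp add: u_def)
    finally show ?thesis .
  qed
  have step1: "eta k * (mu + L) + gam k * rho (CARD('n)) \<le> 2" if "kb \<le> k" for k
    using step_cond1[OF that] by (simp add: eta_def gam_def)
  have y1: "eta k * mu \<le> 1" if "kb \<le> k" for k
    using step_mu_le_1[OF gam eta step1[OF that]] .
  have y0: "0 \<le> eta k * mu" for k
    using eta[of k] muL by simp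
  \<comment> \<open>The bound on \<open>dlt\<close> in the form needed by
    \<open>tracking_recursion\<close>; its factor \<open>5 / 4\<close> becomes the exponent of the
    transient term.\<close>
  have y: "5 / 4 * (dlt / s k) \<le> eta k * mu" for k
    using par_pos s[of k] by (simp add: eta_eq field_simps)
  note contraction = gradient_step_contraction[OF gam eta step1, folded G_def]
  note proj = projN_nonexpansive[OF W_set(2,3,1)]

  \<comment> \<open>The penalised minimisers\<close>
  have "\<exists>Z. G k Z = 0" if "kb \<le> k" for k
    using stationary_point_exists[OF gam eta step1[OF that]] unfolding G_def by blast
  then obtain Z where Z: "\<And>k. kb \<le> k \<Longrightarrow> G k (Z k) = 0"
    by metis
  have Z_dist: "norm (Z k - vec ws) \<le> sqrt N * (gstar * L / (mu * rho 2) * (eta0 / gam0) * u k)"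
    if "kb \<le> k" for k
    using stationary_dist_consensus[OF gam eta Z[OF that, unfolded G_def]]
    by (simp add: ratio N_def mult_ac)
  \<comment> \<open>The second step size condition says exactly that the distance bound is at most
    \<open>zeta\<close>, and each agent's distance to \<open>ws\<close> is at most that of the
    stacked vector.\<close>
  have Z_in: "Z k \<in> WN Wset" if k: "kb \<le> k" for k
  proof -
    have "norm (Z k - vec ws) \<le> eta k / gam k * (sqrt N * gstar * L) / (mu * rho 2)"
      using stationary_dist_consensus[OF gam eta Z[OF that, unfolded G_def]]
      by (simp add: N_def mult_ac)
    also have "\<dots> \<le> zeta * mu * rho 2 / (mu * rho 2)"
      using step_cond2[OF k] muL rho_2
      by (intro divide_right_mono) (auto simp: N_def eta_def gam_def)
    finally have le: "norm (Z k - vec ws) \<le> zeta"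
      using muL rho_2 by simp
    have "Z k $ i \<in> Wset" for i
    proof (rule mem_of_dist_le_frontier)
      have "norm (Z k $ i - ws) \<le> norm (Z k - vec ws)"
        using Finite_Cartesian_Product.norm_nth_le[of "Z k - vec ws" i] by simp
      then show "norm (Z k $ i - ws) \<le> Inf ((\<lambda>w. norm (w - ws)) ` frontier Wset)"
        using le by (simp add: zeta_def)
    qed (use W_set interior_subset in auto)
    then show ?thesis
      by (simp add: WN_def)
  qed
  have Z_arg_min: "arg_min_on (Gfun f Lp (gam k) (eta k)) (WN Wset) = Z k" if "kb \<le> k" for k
    using arg_min_on_eq_stationary[OF gam eta _ Z_in[OF that]] Z[OF that] by (simp add: G_def)

  have W_in: "W k w \<in> WN Wset" "Wb k w \<in> WN Wset" if "kb \<le> k" "w \<in> space M" for k w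
    using that W_init_set Wb_init W_step Wb_step projN_in[OF W_set(2,1)]
    by (cases k rule: nat.exhaust; cases "k = kb"; force simp: le_Suc_eq)+

  \<comment> \<open>Tracking of the minimisers by the noise-free iterates, outcome by
    outcome\<close>
  have tracking: "norm (Wb k w - Z k) \<le> sqrt N * dmW * (s k / s kb) powr (-5/4)
      + exp 1 / 4 * (sqrt N * (gstar * L / (mu * rho 2) * (eta0 / gam0)))
        * (1 + L\<^sup>2 / (mu * rho 2) * (eta0 / gam0) * u k) * u k"
    if k: "kb \<le> k" and w: "w \<in> space M" for k w
  proof (rule tracking_recursion[where D = "\<lambda>k. norm (Wb k w - Z k)" and y = "\<lambda>k. eta k * mu" and kb = kb
        and dlt = dlt and d = "sqrt N * dmW", folded s_def, folded u_def])
    show "1 / 3 \<le> exp 1 / (4::real)"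
      using exp_ge_add_one_self[of 1] by simp
    show "norm (Wb kb w - Z kb) \<le> sqrt N * dmW"
      using norm_WN_diff_le[OF W_set(4) W_in(2)[OF order_refl w] Z_in[OF order_refl]]
      by (simp add: N_def dmW_def)
    show "0 \<le> sqrt N * dmW"
      using diameter_ge_0[OF W_set(4)] N by (simp add: dmW_def)
    fix k assume k: "kb \<le> k"
    have "Wb (Suc k) w = projN Wset (Wb k w - eta k *\<^sub>R G k (Wb k w))"
      using Wb_step[OF k] by (simp add: G_def eta_def gam_def)
    \<comment> \<open>\<open>Z k\<close> is a fixed point of the projected step, so nonexpansiveness
      and contraction compare it with the next iterate.\<close>
    moreover have "Z k = projN Wset (Z k - eta k *\<^sub>R G k (Z k))"
      using Z[OF k] projN_self[OF Z_in[OF k]] by simp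
    ultimately have "norm (Wb (Suc k) w - Z k)
        \<le> norm ((Wb k w - eta k *\<^sub>R G k (Wb k w)) - (Z k - eta k *\<^sub>R G k (Z k)))"
      using proj by metis
    also have "\<dots> \<le> (1 - eta k * mu) * norm (Wb k w - Z k)"
      by (rule contraction[OF k])
    finally have 1: "norm (Wb (Suc k) w - Z k) \<le> (1 - eta k * mu) * norm (Wb k w - Z k)" .
    have "u (Suc k) \<le> u k"
      using par_pos s[of k] unfolding u_def by (intro powr_mono2') (auto simp: s_def)
    then have "eta (Suc k) / gam (Suc k) \<le> eta k / gam k"
      unfolding ratio using par_pos by (intro mult_left_mono) auto
    then have "gam k / eta k \<le> gam (Suc k) / eta (Suc k)"
      using eta gam by (simp add: field_simps)
    note drift = stationary_drift[OF gam eta gam eta this Z[OF k, unfolded G_def] Z[OF le_SucI[OF k], unfolded G_def]]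
    \<comment> \<open>A rearrangement pulling \<open>c = eta0 / gam0\<close> out of the difference
      of ratios, which gives the drift the shape required by
      \<open>tracking_recursion\<close>.\<close>
    have "x * g * l / m * (1 + b * (c * p)) * (c * p - c * r) = x * (g * l / m * c) * (1 + b * c * p) * (p - r)"
      for x g l m b c p r :: real
      by (simp add: divide_inverse algebra_simps)
    note drift[unfolded ratio this]
    then have 2: "norm (Z (Suc k) - Z k) \<le> sqrt N * (gstar * L / (mu * rho 2) * (eta0 / gam0))
        * (1 + L\<^sup>2 / (mu * rho 2) * (eta0 / gam0) * u k) * (u k - u (Suc k))"
      unfolding N_def .
    show "norm (Wb (Suc k) w - Z (Suc k)) \<le> (1 - eta k * mu) * norm (Wb k w - Z k)
        + sqrt N * (gstar * L / (mu * rho 2) * (eta0 / gam0))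
        * (1 + L\<^sup>2 / (mu * rho 2) * (eta0 / gam0) * u k) * (u k - u (Suc k))"
      using norm_triangle_ineq4[of "Wb (Suc k) w - Z k" "Z (Suc k) - Z k"] 1 2 by simp
  qed (use k y y1 par_pos muL rho_2 gstar_nonneg N in auto)

  \<comment> \<open>Adaptedness of the iterates\<close>
  have Fil: "space (Fil k) = space M" "subalgebra (Fil (Suc k)) (Fil k)" for k
    using filt_sub[of k] filt_sub[of "Suc k"] filt_mono[of k] by (auto simp: subalgebra_def)
  have G_cont: "continuous_on UNIV (\<lambda>X. X - eta k *\<^sub>R G k X)" for k
    unfolding G_def by (intro continuous_intros)
  note G_meas = borel_measurable_continuous_on[OF G_cont]
  note proj_meas = borel_measurable_continuous_on[OF continuous_on_projN[OF W_set(2,3,1)]]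
  have meas: "W k \<in> borel_measurable (Fil k)" "Wb k \<in> borel_measurable (Fil k)" if "kb \<le> k" for k
    using that
  proof (induction k rule: dec_induct)
    case (step k)
    have m: "W k \<in> borel_measurable (Fil (Suc k))" "Wb k \<in> borel_measurable (Fil (Suc k))"
      using step measurable_from_subalg[OF Fil(2)] by auto
    have "(\<lambda>w. projN Wset ((W k w - eta k *\<^sub>R G k (W k w)) + gam k *\<^sub>R eps1 k w - eta k *\<^sub>R eps2 k w))
        \<in> borel_measurable (Fil (Suc k))"
      using eps1_meas[of k] eps2_meas[of k] step
      by (intro proj_meas borel_measurable_add borel_measurable_diff borel_measurable_scaleR
          borel_measurable_const G_meas m) auto
    then show "W (Suc k) \<in> borel_measurable (Fil (Suc k))"
      using W_step[of k] step
      by (subst measurable_cong) (auto simp: Fil G_def eta_def gam_def)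
    have "(\<lambda>w. projN Wset (Wb k w - eta k *\<^sub>R G k (Wb k w))) \<in> borel_measurable (Fil (Suc k))"
      by (intro proj_meas G_meas m)
    then show "Wb (Suc k) \<in> borel_measurable (Fil (Suc k))"
      using Wb_step[of k] step
      by (subst measurable_cong) (auto simp: Fil G_def eta_def gam_def)
  qed (use W_init_meas Wb_init in auto)

  \<comment> \<open>Mean squared effect of the noise\<close>
  define V where "V k = expectation (\<lambda>w. (norm (W k w - Wb k w))\<^sup>2)" for k
  \<comment> \<open>Chosen so that \<open>eta k * mu * q k\<close> equals the injected variance
    \<open>N * ((gam k)^2 * Sig1 + (eta k)^2 * Sig2)\<close>.\<close>
  define q where "q k = N / mu * (gam0\<^sup>2 / eta0 * Sig1 * s k powr (-1/2) + eta0 * Sig2 * s k powr (-1))" for k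
  have V_step: "V (Suc k) \<le> (1 - eta k * mu)\<^sup>2 * V k + eta k * mu * q k" if k: "kb \<le> k" for k
  proof -
    \<comment> \<open>The difference of the two gradient steps without noise: bounded, measurable at
      time \<open>k\<close>, and contracted. The noise is added to it before nonexpansiveness
      removes the projections.\<close>
    define X where "X w = (W k w - eta k *\<^sub>R G k (W k w)) - (Wb k w - eta k *\<^sub>R G k (Wb k w))" for w
    have X: "X \<in> borel_measurable (Fil k)"
      unfolding X_def by (intro borel_measurable_diff G_meas meas k)
    have X_le: "norm (X w) \<le> (1 - eta k * mu) * norm (W k w - Wb k w)" for w
      unfolding X_def by (rule contraction[OF k])
    have bd: "norm (W k w - Wb k w) \<le> sqrt N * dmW" if "w \<in> space M" for w
      using norm_WN_diff_le[OF W_set(4) W_in(1)[OF k that] W_in(2)[OF k that]] by (simp add: N_def dmW_def)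
    have X_bd: "norm (X w) \<le> sqrt N * dmW" if "w \<in> space M" for w
    proof -
      have "(1 - eta k * mu) * norm (W k w - Wb k w) \<le> 1 * norm (W k w - Wb k w)"
        using y0[of k] by (intro mult_right_mono) auto
      then show ?thesis
        using X_le[of w] bd[OF that] by simp
    qed
    have eM: "eps1 k \<in> borel_measurable M" "eps2 k \<in> borel_measurable M"
      using eps1_meas[OF k] eps2_meas[OF k] measurable_from_subalg[OF filt_sub] by auto
    have v: "AE w in M. real_cond_exp M (Fil k) (\<lambda>w. (norm (eps1 k w))\<^sup>2) w \<le> N * Sig1"
      "AE w in M. real_cond_exp M (Fil k) (\<lambda>w. (norm (eps2 k w))\<^sup>2) w \<le> N * Sig2"
      using eps1_var[OF k] eps2_var[OF k] N by (simp_all add: N_def pos_divide_le_eq mult.commute)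
    note noisy = expectation_noisy_square_le[OF filt_sub X X_bd eM(1) eps1_int[OF k] eps1_mean[OF k] v(1)
        eM(2) eps2_int[OF k] eps2_mean[OF k] v(2) eps_uncorr[OF k], of "gam k" "eta k"]
    have "V (Suc k) \<le> expectation (\<lambda>w. (norm (X w + gam k *\<^sub>R eps1 k w - eta k *\<^sub>R eps2 k w))\<^sup>2)"
      unfolding V_def
    proof (intro integral_mono_AE' noisy(1) AE_I2 power_mono)
      fix w assume w: "w \<in> space M"
      have "W (Suc k) w = projN Wset ((W k w - eta k *\<^sub>R G k (W k w)) + gam k *\<^sub>R eps1 k w - eta k *\<^sub>R eps2 k w)"
        "Wb (Suc k) w = projN Wset (Wb k w - eta k *\<^sub>R G k (Wb k w))"
        using W_step[OF k w] Wb_step[OF k] by (simp_all add: G_def eta_def gam_def)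
      then have "norm (W (Suc k) w - Wb (Suc k) w)
          \<le> norm (((W k w - eta k *\<^sub>R G k (W k w)) + gam k *\<^sub>R eps1 k w - eta k *\<^sub>R eps2 k w)
             - (Wb k w - eta k *\<^sub>R G k (Wb k w)))"
        using proj by metis
      then show "norm (W (Suc k) w - Wb (Suc k) w) \<le> norm (X w + gam k *\<^sub>R eps1 k w - eta k *\<^sub>R eps2 k w)"
        by (simp add: X_def algebra_simps)
    qed auto
    also have "\<dots> \<le> expectation (\<lambda>w. (norm (X w))\<^sup>2) + (gam k)\<^sup>2 * (N * Sig1) + (eta k)\<^sup>2 * (N * Sig2)"
      by (rule noisy(2))
    also have "expectation (\<lambda>w. (norm (X w))\<^sup>2)
        \<le> expectation (\<lambda>w. (1 - eta k * mu)\<^sup>2 * (norm (W k w - Wb k w))\<^sup>2)"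
    proof (intro integral_mono_AE' AE_I2)
      have "integrable M (\<lambda>w. (norm (W k w - Wb k w))\<^sup>2)"
      proof (rule integrable_const_bound[where B = "(sqrt N * dmW)\<^sup>2"])
        show "AE w in M. norm ((norm (W k w - Wb k w))\<^sup>2) \<le> (sqrt N * dmW)\<^sup>2"
          using bd by (intro AE_I2) (simp add: power_mono)
        show "(\<lambda>w. (norm (W k w - Wb k w))\<^sup>2) \<in> borel_measurable M"
          using meas[OF k, THEN measurable_from_subalg[OF filt_sub]] by measurable
      qed
      then show "integrable M (\<lambda>w. (1 - eta k * mu)\<^sup>2 * (norm (W k w - Wb k w))\<^sup>2)"
        by simp
      show "(norm (X w))\<^sup>2 \<le> (1 - eta k * mu)\<^sup>2 * (norm (W k w - Wb k w))\<^sup>2" for w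
        using power_mono[OF X_le[of w], of 2] by (simp add: power_mult_distrib)
    qed auto
    also have "\<dots> = (1 - eta k * mu)\<^sup>2 * V k"
      by (simp add: V_def)
    also have "(1 - eta k * mu)\<^sup>2 * V k + (gam k)\<^sup>2 * (N * Sig1) + (eta k)\<^sup>2 * (N * Sig2)
        = (1 - eta k * mu)\<^sup>2 * V k + eta k * mu * q k"
    proof -
      have "(gam k)\<^sup>2 = gam0\<^sup>2 * (s k powr (-3/4) * s k powr (-3/4))"
        by (simp add: gam_def gam_k_def s_def power2_eq_square)
      also have "s k powr (-3/4) * s k powr (-3/4) = s k powr (-1/2) / s k"
        using s[of k] powr_diff[of "s k" "-1/2" 1] by (simp flip: powr_add)
      finally have "(gam k)\<^sup>2 = eta k * (gam0\<^sup>2 / eta0 * s k powr (-1/2))"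
        using par_pos by (simp add: eta_eq)
      moreover have "(eta k)\<^sup>2 = eta k * (eta0 * s k powr (-1))"
        by (simp add: power2_eq_square eta_def eta_k_def s_def)
      ultimately show ?thesis
        using muL by (simp add: q_def algebra_simps)
    qed
    finally show ?thesis
      by simp
  qed
  have e2: "2 \<le> exp (1::real)"
    using exp_ge_add_one_self[of 1] by simp
  have V_bound: "V k \<le> 5 / 4 * (exp 1)\<^sup>2 * q k" if "kb \<le> k" for k
    using _ _ _ _ _ _ _ that
  proof (rule variance_recursion[where y = "\<lambda>k. eta k * mu" and kb = kb])
    \<comment> \<open>The constant is the square of \<open>sqrt 5 * exp 1 / 2\<close>; the recursion
      asks only for 5, so \<open>exp 1 \<ge> 2\<close> suffices.\<close>
    show "5 \<le> 5 / 4 * (exp (1::real))\<^sup>2"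
      using power_mono[OF e2, of 2] by simp
    show "V kb \<le> 0"
      by (simp add: V_def Wb_init)
    show "0 \<le> q k" for k
      using N muL par_pos Sig_nonneg by (simp add: q_def)
    show "(1 - 4 / 5 * (eta k * mu)) * q k \<le> q (Suc k)" if "kb \<le> k" for k
    proof -
      define x where "x = dlt / s k"
      have "0 \<le> x"
        using s[of k] par_pos by (simp add: x_def)
      moreover have "x \<le> 4 / 5 * (eta k * mu)"
        using y[of k] unfolding x_def[symmetric] by linarith
      ultimately have x: "0 \<le> x" "x \<le> 4 / 5 * (eta k * mu)" .
      have S: "s (Suc k) powr a = s k powr a * (1 + x) powr a" for a
        using step_scale_Suc[of dlt k a] par_pos by (simp add: s_def x_def)
      \<comment> \<open>Both decay exponents of \<open>q\<close> are at most 1, and \<open>x\<close>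
        is at most \<open>4 / 5 * (eta k * mu)\<close>.\<close>
      have b: "1 - 4 / 5 * (eta k * mu) \<le> (1 + x) powr (-1/2)" "1 - 4 / 5 * (eta k * mu) \<le> (1 + x) powr (-1)"
        using powr_minus_ge_linear[OF x(1), of "1/2"] powr_minus_ge_linear[OF x(1), of 1] x by auto
      have distrib: "(1 - t) * (n * (a * p + b * r)) = n * (a * (p * (1 - t)) + b * (r * (1 - t)))" for t n a b p r :: real
        by (simp add: algebra_simps)
      have "(1 - 4 / 5 * (eta k * mu)) * q k
          = N / mu * (gam0\<^sup>2 / eta0 * Sig1 * (s k powr (-1/2) * (1 - 4 / 5 * (eta k * mu)))
              + eta0 * Sig2 * (s k powr (-1) * (1 - 4 / 5 * (eta k * mu))))"
        unfolding q_def by (rule distrib)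
      also have "\<dots> \<le> q (Suc k)"
        unfolding q_def S using b N muL par_pos Sig_nonneg
        by (intro mult_left_mono add_mono) auto
      finally show ?thesis .
    qed
  qed (use V_step y0 y1 in auto)

  \<comment> \<open>Assembling the three bounds\<close>
  show ?thesis
    unfolding N_def[symmetric] s_def[symmetric] u_def[symmetric] eta_def[symmetric] gam_def[symmetric]
  proof (intro allI impI conjI)
    fix k assume k: "kb \<le> k"
    let ?a = "gam0 / sqrt eta0 * sqrt Sig1" and ?b = "sqrt (eta0 * Sig2) * u k"
    have ab: "0 \<le> ?a" "0 \<le> ?b"
      using par_pos Sig_nonneg u[of k] by auto
    have "q k = N / mu * ((?a\<^sup>2 + ?b\<^sup>2) * (u k)\<^sup>2)"
    proof -
      have s1: "s k powr (-1) = (u k)\<^sup>2 * (u k)\<^sup>2"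
        unfolding power2_eq_square u2 by (simp flip: powr_add)
      have s2: "s k powr (-1/2) = (u k)\<^sup>2"
        by (simp add: power2_eq_square u2)
      have ab2: "?a\<^sup>2 = gam0\<^sup>2 / eta0 * Sig1" "?b\<^sup>2 = eta0 * Sig2 * (u k)\<^sup>2"
        using par_pos Sig_nonneg by (simp_all add: power_mult_distrib power_divide)
      show ?thesis
        unfolding q_def s1 s2 ab2 by (simp only: distrib_right mult.assoc)
    qed
    also have "\<dots> \<le> N / mu * ((?a + ?b)\<^sup>2 * (u k)\<^sup>2)"
    proof (intro mult_left_mono mult_right_mono)
      \<comment> \<open>Passing to the square of the sum lets the square root below produce the
        stated sum of two noise terms.\<close>
      show "?a\<^sup>2 + ?b\<^sup>2 \<le> (?a + ?b)\<^sup>2"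
        using mult_nonneg_nonneg[OF ab] unfolding power2_sum mult.assoc by linarith
    qed (use N muL in auto)
    finally have "V k \<le> 5 / 4 * (exp 1)\<^sup>2 * (N / mu * ((?a + ?b)\<^sup>2 * (u k)\<^sup>2))"
      using V_bound[OF k] by (meson mult_left_mono order_trans zero_le_power2 mult_nonneg_nonneg zero_le_divide_iff zero_le_numeral)
    also have "\<dots> = (sqrt N * (sqrt 5 * exp 1 / (2 * sqrt mu) * (?a + ?b) * u k))\<^sup>2"
      using N muL by (simp add: power_mult_distrib power_divide)
    finally have "Enorm M (\<lambda>w. W k w - Wb k w) \<le> sqrt N * (sqrt 5 * exp 1 / (2 * sqrt mu) * (?a + ?b) * u k)"
      unfolding Enorm_def V_def[symmetric] using ab u[of k] muL N by (intro real_le_lsqrt) auto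
    then show "1 / sqrt N * Enorm M (\<lambda>w. W k w - Wb k w)
        \<le> sqrt 5 * exp 1 / (2 * sqrt mu) * (?a + ?b) * u k"
      using N by (simp add: pos_divide_le_eq mult.commute)
  next
    fix k assume k: "kb \<le> k"
    define R where "R = dmW * (s k / s kb) powr (-5/4)
      + gstar * L / (mu * rho 2) * (exp 1 / 4) * (eta0 / gam0)
        * (1 + L\<^sup>2 / (mu * rho 2) * (eta0 / gam0) * u k) * u k"
    have R: "0 \<le> R"
      using diameter_ge_0[OF W_set(4)] u[of k] par_pos muL rho_2 gstar_nonneg
      by (simp add: R_def dmW_def)
    \<comment> \<open>The tracking bound holds at every outcome with a deterministic right side, so
      it carries over to the mean-square norm.\<close>
    have "Enorm M (\<lambda>w. Wb k w - Z k) \<le> sqrt N * R"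
    proof (rule Enorm_le_const)
      show "norm (Wb k w - Z k) \<le> sqrt N * R" if "w \<in> space M" for w
        using tracking[OF k that] by (simp add: R_def algebra_simps)
    qed (use N R in auto)
    moreover have "s k / s kb = 1 + dlt * (real k - real kb) / s kb"
      using s[of kb] by (simp add: s_def field_simps)
    ultimately show "1 / sqrt N * Enorm M (\<lambda>w. Wb k w - arg_min_on (Gfun f Lp (gam k) (eta k)) (WN Wset))
        \<le> dmW * (1 + dlt * (real k - real kb) / s kb) powr (-5/4)
          + gstar * L / (mu * rho 2) * (exp 1 / 4) * (eta0 / gam0)
            * (1 + L\<^sup>2 / (mu * rho 2) * (eta0 / gam0) * u k) * u k"
      using N unfolding Z_arg_min[OF k] by (simp add: R_def pos_divide_le_eq mult.commute)
  next
    fix k assume k: "kb \<le> k"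
    show "1 / sqrt N * norm (arg_min_on (Gfun f Lp (gam k) (eta k)) (WN Wset) - vec ws)
        \<le> gstar * L / (mu * rho 2) * (eta0 / gam0) * u k"
      using Z_dist[OF k] N unfolding Z_arg_min[OF k] by (simp add: pos_divide_le_eq mult.commute)
  qed
qed

end
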